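(* In the downlink PD-NOMA model of the context (one subcarrier, $K=1$) with imperfect SIC ($\varpi=1$), assume $a_m>\varepsilon_m a_n$ and $a_n>\varepsilon_n a_m$. Put $\tau=\frac{\varepsilon_m}{\rho(a_m-\varepsilon_m a_n)}$, $\upsilon=\frac{\varepsilon_n}{\rho(a_n-\varepsilon_n a_m)}$, $\zeta=\min(\tau,\upsilon)$, $\vartheta=\frac{\varpi\varepsilon_n}{a_n}$. At high SNR, the connection outage probability of the $n$-th user for the alternative formulation (ALF), $P_{n2,PD}^{ipSIC}=\Pr\{\gamma_{n\to m}\le\varepsilon_m,\gamma_{n\to n}\le\varepsilon_n\}+\Pr\{\gamma_{n\to m}>\varepsilon_m,\gamma_n\le\varepsilon_n\}$, has the asymptotic form $$\begin{aligned}P_{n2,PD}^{ipSIC,\infty}\approx{}&\frac{M!}{(M-n)!\,n!}\left[\sum_{u=1}^U b_u\left(\frac{\zeta c_u}{\eta}\right)\right]^n-\frac{M!}{(M-n)!\,n!}\left[\sum_{u=1}^U b_u\left(\frac{\tau c_u}{\eta}\right)\right]^n\\&+\frac{\phi_n}{\Omega_I}\sum_{p=0}^{M-n}\binom{M-n}{p}\frac{(-1)^p}{n+p}\int_0^\infty e^{-\frac{y}{\Omega_I}}\left[\sum_{u=1}^U b_u\left(1-e^{-\frac{y\vartheta c_u}{\eta}}\right)\right]^{n+p}dy,\end{aligned}$$ i.e. the ratio of $P_{n2,PD}^{ipSIC}$ to the limit as $U\to\infty$ of the right-hand side tends to $1$ as $\rho\to\infty$.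
   Context: Fix integers $M\ge2$ and $1\le m<n\le M$, reals $\eta,\alpha,R_D,\Omega_I>0$, power coefficients $a_m>a_n>0$ with $a_m+a_n=1$, and target rates $R_m,R_n>0$ with $\varepsilon_m=2^{R_m}-1$, $\varepsilon_n=2^{R_n}-1$; $\rho>0$ is the transmit SNR. $M$ users are placed independently and uniformly in a disc of radius $R_D$ centred at the base station. A user at distance $d$ from the centre has channel coefficient $\sqrt{\eta}\,h/\sqrt{1+d^\alpha}$ with $h\sim\mathcal{CN}(0,1)$ (circularly symmetric, $\mathbb{E}|h|^2=1$), independent across users and of the locations. Users are relabelled so that their squared channel moduli satisfy $Z_1<\dots<Z_M$. The residual interference coefficient $h_I\sim\mathcal{CN}(0,\Omega_I)$ is independent of everything else, and $Y_I=|h_I|^2$. SINRs: $\gamma_{n\to m}=\frac{\rho Z_n a_m}{\rho Z_n a_n+1}$, $\gamma_n=\frac{\rho Z_n a_n}{\varpi\rho Y_I+1}$ (with $\varpi=1$ for imperfect SIC), $\gamma_{n\to n}=\frac{\rho Z_n a_n}{\rho Z_n a_m+1}$. Notation: $\phi_n=\frac{M!}{(M-n)!(n-1)!}$; for a positive integer $U$ (number of Gauss–Chebyshev quadrature nodes), $\theta_u=\cos\left(\frac{2u-1}{2U}\pi\right)$, $b_u=\frac{\pi}{2U}\sqrt{1-\theta_u^2}\,(\theta_u+1)$, $c_u=1+\left(\frac{R_D}{2}(\theta_u+1)\right)^\alpha$. *)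

theory Defs
  imports "HOL-Probability.Probability"
begin

section \<open>Random network\<close>

definition complex_gaussian_density :: "real \<Rightarrow> complex \<Rightarrow> real" where
  "complex_gaussian_density v z = exp (- (cmod z)\<^sup>2 / v) / (pi * v)"

text \<open>
  The plane is identified with \<^typ>\<open>complex\<close>, the base station being at the origin. The
  constructors of \<open>source\<close> only index the sources of randomness, so that the joint
  independence of all of them can be stated for a single family.
\<close>

datatype source = Position nat | Fading nat | Residual

locale noma_downlink = prob_space P for P :: "'w measure" +
  fixes M :: nat
    and R\<^sub>D :: real
    and \<Omega>\<^sub>I :: real
    and pos :: "nat \<Rightarrow> 'w \<Rightarrow> complex"
    and h :: "nat \<Rightarrow> 'w \<Rightarrow> complex"
    and h\<^sub>I :: "'w \<Rightarrow> complex"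
  assumes pos_uniform: "\<And>i. i \<in> {1..M} \<Longrightarrow>
      distributed P lborel (pos i)
        (\<lambda>x. ennreal (indicator (cball 0 R\<^sub>D) x / measure lborel (cball (0::complex) R\<^sub>D)))"
    and fading_gaussian: "\<And>i. i \<in> {1..M} \<Longrightarrow>
      distributed P lborel (h i) (\<lambda>z. ennreal (complex_gaussian_density 1 z))"
    and residual_gaussian:
      "distributed P lborel h\<^sub>I (\<lambda>z. ennreal (complex_gaussian_density \<Omega>\<^sub>I z))"
    and independent:
      "indep_vars (\<lambda>_. borel)
        (\<lambda>s. case s of Position i \<Rightarrow> pos i | Fading i \<Rightarrow> h i | Residual \<Rightarrow> h\<^sub>I)
        (Position ` {1..M} \<union> Fading ` {1..M} \<union> {Residual})"

definition channel_coeff :: "real \<Rightarrow> real \<Rightarrow> complex \<Rightarrow> complex \<Rightarrow> complex" where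
  "channel_coeff \<eta> \<alpha> x g =
     complex_of_real (sqrt \<eta>) * g / complex_of_real (sqrt (1 + cmod x powr \<alpha>))"

text \<open>
  The \<open>k\<close>-th smallest squared channel modulus (\<open>1 \<le> k \<le> M\<close>) of the \<open>M\<close> users. Ties, which
  are a null event, are harmless.
\<close>

definition ordered_gain ::
  "nat \<Rightarrow> real \<Rightarrow> real \<Rightarrow> (nat \<Rightarrow> 'w \<Rightarrow> complex) \<Rightarrow> (nat \<Rightarrow> 'w \<Rightarrow> complex) \<Rightarrow> nat \<Rightarrow> 'w \<Rightarrow> real" where
  "ordered_gain M \<eta> \<alpha> pos h k \<omega> =
     sort (map (\<lambda>i. (cmod (channel_coeff \<eta> \<alpha> (pos i \<omega>) (h i \<omega>)))\<^sup>2) [1..<Suc M]) ! (k - 1)"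


section \<open>SINRs and outage probability\<close>

text \<open>
  In the following, \<open>z\<close> is the channel gain of user \<open>n\<close> and \<open>y\<close> the gain of the residual
  interference. \<open>sinr_n_to_m\<close> and \<open>sinr_n_to_n\<close> are the SINRs at user \<open>n\<close> when it decodes the
  signal of \<open>m\<close>, respectively its own signal, treating the other one as noise;
  \<open>sinr_n\<close> is the one for its own signal after interference cancellation.
\<close>

definition sinr_n_to_m :: "real \<Rightarrow> real \<Rightarrow> real \<Rightarrow> real \<Rightarrow> real" where
  "sinr_n_to_m a\<^sub>m a\<^sub>n \<rho> z = \<rho> * z * a\<^sub>m / (\<rho> * z * a\<^sub>n + 1)"

definition sinr_n_to_n :: "real \<Rightarrow> real \<Rightarrow> real \<Rightarrow> real \<Rightarrow> real" where
  "sinr_n_to_n a\<^sub>m a\<^sub>n \<rho> z = \<rho> * z * a\<^sub>n / (\<rho> * z * a\<^sub>m + 1)"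

definition sinr_n :: "real \<Rightarrow> real \<Rightarrow> real \<Rightarrow> real \<Rightarrow> real \<Rightarrow> real" where
  "sinr_n varpi a\<^sub>n \<rho> z y = \<rho> * z * a\<^sub>n / (varpi * \<rho> * y + 1)"

definition alf_outage ::
  "'w measure \<Rightarrow> real \<Rightarrow> real \<Rightarrow> real \<Rightarrow> real \<Rightarrow> real \<Rightarrow> real \<Rightarrow> ('w \<Rightarrow> real) \<Rightarrow> ('w \<Rightarrow> real) \<Rightarrow> real" where
  "alf_outage P varpi a\<^sub>m a\<^sub>n \<epsilon>\<^sub>m \<epsilon>\<^sub>n \<rho> Z Y =
     \<P>(\<omega> in P. sinr_n_to_m a\<^sub>m a\<^sub>n \<rho> (Z \<omega>) \<le> \<epsilon>\<^sub>m \<and> sinr_n_to_n a\<^sub>m a\<^sub>n \<rho> (Z \<omega>) \<le> \<epsilon>\<^sub>n) +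
     \<P>(\<omega> in P. sinr_n_to_m a\<^sub>m a\<^sub>n \<rho> (Z \<omega>) > \<epsilon>\<^sub>m \<and> sinr_n varpi a\<^sub>n \<rho> (Z \<omega>) (Y \<omega>) \<le> \<epsilon>\<^sub>n)"


section \<open>Gauss--Chebyshev approximation\<close>

definition node :: "nat \<Rightarrow> nat \<Rightarrow> real" where
  "node U u = cos ((2 * real u - 1) / (2 * real U) * pi)"

definition weight :: "nat \<Rightarrow> nat \<Rightarrow> real" where
  "weight U u = pi / (2 * real U) * sqrt (1 - (node U u)\<^sup>2) * (node U u + 1)"

definition path_loss :: "real \<Rightarrow> real \<Rightarrow> nat \<Rightarrow> nat \<Rightarrow> real" where
  "path_loss R\<^sub>D \<alpha> U u = 1 + (R\<^sub>D / 2 * (node U u + 1)) powr \<alpha>"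

definition alf_asymptotic ::
  "nat \<Rightarrow> nat \<Rightarrow> real \<Rightarrow> real \<Rightarrow> real \<Rightarrow> real \<Rightarrow> real \<Rightarrow> real \<Rightarrow> real \<Rightarrow> nat \<Rightarrow> real" where
  "alf_asymptotic M n \<eta> \<alpha> R\<^sub>D \<Omega>\<^sub>I \<zeta> \<tau> vartheta U =
     fact M / (fact (M - n) * fact n) *
       (\<Sum>u=1..U. weight U u * (\<zeta> * path_loss R\<^sub>D \<alpha> U u / \<eta>)) ^ n
     - fact M / (fact (M - n) * fact n) *
       (\<Sum>u=1..U. weight U u * (\<tau> * path_loss R\<^sub>D \<alpha> U u / \<eta>)) ^ n
     + fact M / (fact (M - n) * fact (n - 1)) / \<Omega>\<^sub>I *
       (\<Sum>p=0..M - n. real ((M - n) choose p) * ((-1) ^ p / real (n + p)) *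
         (LBINT y:{0..}. exp (- y / \<Omega>\<^sub>I) *
           (\<Sum>u=1..U. weight U u * (1 - exp (- (y * vartheta * path_loss R\<^sub>D \<alpha> U u / \<eta>)))) ^ (n + p)))"

end

theory Submission
  imports Defs
begin

text \<open>
  As \<open>\<rho> \<rightarrow> \<infinity>\<close>, user \<open>n\<close> decodes the signal of \<open>m\<close> almost surely, and its own SINR after
  cancellation falls below \<open>\<epsilon>\<^sub>n\<close> in the limit exactly when \<open>Z\<^sub>n \<le> \<vartheta> Y\<^sub>I\<close>; by dominated
  convergence the outage probability tends to the error floor \<open>Pr (Z\<^sub>n \<le> \<vartheta> Y\<^sub>I) > 0\<close>.
  Conditioning on \<open>Y\<^sub>I\<close>, which is exponential, and inserting the distribution function of the
  \<open>n\<close>-th order statistic shows that the integral term of the asymptotic expression, with the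
  quadrature sums replaced by their limits, equals this floor for every \<open>\<rho>\<close>; the other two
  terms vanish like \<open>\<rho>\<close> to the power \<open>-n\<close>. So numerator and denominator have the same positive limit.
\<close>


section \<open>Gauss--Chebyshev quadrature\<close>

text \<open>On each cell the mean value theorem turns the increment of \<open>G\<close> into a value
  of \<open>g\<close> times the cell width, and uniform continuity moves that point to the midpoint.
  Working with an antiderivative \<open>G\<close> lets the later change of variables be done by the
  chain rule alone.\<close>

lemma midpoint_sums_tendsto:
  fixes G g :: "real \<Rightarrow> real"
  assumes b: "b > 0" and cont: "continuous_on {0..b} g"
    and deriv: "\<And>x. x \<in> {0..b} \<Longrightarrow> (G has_real_derivative g x) (at x within {0..b})"
  shows "(\<lambda>U. \<Sum>u=1..U. b / real U * g ((2 * real u - 1) / (2 * real U) * b))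
           \<longlonglongrightarrow> G b - G 0"
proof (rule LIMSEQ_I)
  fix e :: real assume e: "e > 0"
  have "uniformly_continuous_on {0..b} g"
    using cont by (rule compact_uniformly_continuous) simp
  \<comment> \<open>The tolerance \<open>e / (2 * b)\<close>, integrated over an interval of length
    \<open>b\<close>, gives a total error of at most \<open>e / 2\<close>.\<close>
  then obtain d where d: "d > 0"
    and close: "\<And>x y. x \<in> {0..b} \<Longrightarrow> y \<in> {0..b} \<Longrightarrow> dist y x < d \<Longrightarrow> dist (g y) (g x) < e / (2 * b)"
    unfolding uniformly_continuous_on_def using e b by (metis divide_pos_pos mult_pos_pos zero_less_numeral)
  obtain N :: nat where N: "b / d < real N" using reals_Archimedean2 by blast
  show "\<exists>no. \<forall>U\<ge>no. norm ((\<Sum>u=1..U. b / real U * g ((2 * real u - 1) / (2 * real U) * b)) - (G b - G 0)) < e"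
  proof (intro exI allI impI)
    fix U :: nat assume U: "U \<ge> max 1 N"
    define x where "x u = real u * b / real U" for u :: nat
    define mid where "mid u = (2 * real u - 1) / (2 * real U) * b" for u :: nat
    have U0: "real U > 0" using U by simp
    have "b / d < real U" using N U by simp
    then have h: "b / real U < d" using d U0 by (simp add: field_simps)
    have step: "\<bar>b / real U * g (mid u) - (G (x u) - G (x (u - 1)))\<bar> \<le> b / real U * (e / (2 * b))"
      if u: "u \<in> {1..U}" for u
    proof -
      have xu: "x u - x (u - 1) = b / real U"
        using u by (simp add: x_def of_nat_diff field_simps)
      have lo: "0 \<le> x (u - 1)" using b by (simp add: x_def)
      have hi: "x u \<le> b" using u b U0 by (simp add: x_def field_simps)
      have lt: "x (u - 1) < x u" using xu b U0 by (simp add: algebra_simps)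
      have sub: "{x (u - 1)..x u} \<subseteq> {0..b}" using lo hi by auto
      have "\<exists>z\<in>{x (u - 1)<..<x u}. G (x u) - G (x (u - 1)) = (*) (g z) (x u - x (u - 1))"
      proof (rule mvt_simple[OF lt])
        fix t assume "x (u - 1) \<le> t" "t \<le> x u"
        then show "(G has_derivative (*) (g t)) (at t within {x (u - 1)..x u})"
          using deriv[of t] sub unfolding has_field_derivative_def
          by (auto intro: has_derivative_subset)
      qed
      then obtain z where z: "x (u - 1) < z" "z < x u"
        "G (x u) - G (x (u - 1)) = g z * (x u - x (u - 1))" by auto
      have mid: "mid u = x (u - 1) + b / (2 * real U)"
        using u U0 by (simp add: mid_def x_def of_nat_diff field_simps)
      \<comment> \<open>The midpoint and the mean value point \<open>z\<close> lie in the same cell,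
        whose width \<open>b / real U\<close> is below \<open>d\<close>.\<close>
      have "x (u-1) \<le> mid u" "mid u \<le> x u"
        using xu b U0 unfolding mid by (auto simp: field_simps)
      then have "\<bar>g (mid u) - g z\<bar> \<le> e / (2 * b)"
        using close[of z "mid u"] z xu h lo hi by (force simp: dist_real_def)
      moreover have "b / real U * g (mid u) - (G (x u) - G (x (u - 1))) = b / real U * (g (mid u) - g z)"
        using z(3) xu by (simp add: algebra_simps)
      moreover have "0 \<le> b / real U" using b by simp
      ultimately show ?thesis by (simp only: abs_mult abs_of_nonneg mult_left_mono)
    qed
    have tel: "(\<Sum>u=1..U. G (x u) - G (x (u - 1))) = G b - G 0"
    proof -
      have "(\<Sum>u=1..k. G (x u) - G (x (u - 1))) = G (x k) - G (x 0)" for k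
        by (induction k) auto
      then show ?thesis using U0 by (simp add: x_def)
    qed
    have "norm ((\<Sum>u=1..U. b / real U * g (mid u)) - (G b - G 0))
        = \<bar>\<Sum>u=1..U. b / real U * g (mid u) - (G (x u) - G (x (u - 1)))\<bar>"
      unfolding tel[symmetric] by (simp add: sum_subtractf)
    also have "\<dots> \<le> (\<Sum>u=1..U. b / real U * (e / (2 * b)))"
      by (rule order_trans[OF sum_abs]) (intro sum_mono step)
    also have "\<dots> = e / 2" using U0 b by simp
    also have "\<dots> < e" using e by simp
    finally show "norm ((\<Sum>u=1..U. b / real U * g ((2 * real u - 1) / (2 * real U) * b)) - (G b - G 0)) < e"
      unfolding mid_def .
  qed
qed

section \<open>Uniform bounds on nodes and weights\<close>

lemma abs_node_le_1: "\<bar>node U u\<bar> \<le> 1"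
  unfolding node_def by (rule abs_cos_le_one)

lemma weight_nonneg: "0 \<le> weight U u"
  unfolding weight_def using abs_node_le_1[of U u]
  by (intro mult_nonneg_nonneg) (auto simp: abs_square_le_1)

text \<open>Each weight is at most \<open>pi / real U\<close>. The sums actually tend to 1, but any
  bound uniform in \<open>U\<close> suffices for dominated convergence.\<close>

lemma sum_weight_le: "(\<Sum>u=1..U. weight U u) \<le> pi"
proof -
  have "weight U u \<le> pi / (2 * real U) * 1 * 2" for u
    unfolding weight_def using abs_node_le_1[of U u]
    by (intro mult_mono) (auto simp: abs_square_le_1)
  then have "(\<Sum>u=1..U. weight U u) \<le> (\<Sum>u=1..U. pi / (2 * real U) * 1 * 2)"
    by (rule sum_mono)
  then show ?thesis by (cases "U = 0") auto
qed

text \<open>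
  With nodes \<open>cos \<phi>\<close> the quadrature rule is a midpoint Riemann sum in \<open>\<phi>\<close>, and
  \<open>s = (R / 2 * (cos \<phi> + 1))\<^sup>2\<close> turns the integral over \<open>\<phi>\<close> into the one over the uniformly
  distributed squared distance \<open>s\<close>.
\<close>

lemma quadrature_tendsto:
  fixes k :: "real \<Rightarrow> real"
  assumes R: "R > 0" and k: "continuous_on {0..R} k"
  shows "(\<lambda>U. \<Sum>u=1..U. weight U u * k (R / 2 * (node U u + 1)))
           \<longlonglongrightarrow> integral {0..R\<^sup>2} (\<lambda>s. k (sqrt s)) / R\<^sup>2"
proof -
  define K where "K s = integral {0..s} (\<lambda>s. k (sqrt s))" for s
  define r where "r t = R / 2 * (cos t + 1)" for t :: real
  \<comment> \<open>This is the summand with nodes \<open>cos t\<close>, the square root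
    \<open>sqrt (1 - (cos t)\<^sup>2)\<close> replaced by \<open>sin t\<close> and the mesh width
    \<open>pi / real U\<close> split off.\<close>
  define g where "g t = 1 / 2 * sin t * (cos t + 1) * k (r t)" for t
  have r: "r t \<in> {0..R}" for t
    using R cos_ge_minus_one[of t] mult_left_mono[of "cos t + 1" 2 "R / 2"] by (auto simp: r_def simp del: cos_ge_minus_one)
  have r2: "(r t)\<^sup>2 \<in> {0..R\<^sup>2}" for t using r[of t] by (auto intro: power_mono)
  have "continuous_on {0..R\<^sup>2} (\<lambda>s. k (sqrt s))"
    using R by (intro continuous_on_compose2[OF k] continuous_intros) (auto intro!: real_le_lsqrt)
  then have dK: "(K has_real_derivative k (sqrt s)) (at s within {0..R\<^sup>2})" if "s \<in> {0..R\<^sup>2}" for s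
    unfolding K_def using integral_has_real_derivative that by blast
  have dr: "((\<lambda>t. (r t)\<^sup>2) has_real_derivative (2 * r t * (R / 2 * (- sin t)))) (at t within S)" for t S
  proof -
    have "(r has_real_derivative (R / 2 * (- sin t))) (at t within S)"
      unfolding r_def by (auto intro!: derivative_eq_intros)
    from DERIV_power[OF this, of 2] show ?thesis by (simp add: mult_ac)
  qed
  \<comment> \<open>The chain rule exhibits an antiderivative of \<open>g\<close>. The minus sign
    appears because \<open>r\<close> decreases from \<open>R\<close> to 0 as \<open>t\<close> runs
    from 0 to \<open>pi\<close>.\<close>
  have "((\<lambda>t. - K ((r t)\<^sup>2) / R\<^sup>2) has_real_derivative g t) (at t within {0..pi})" for t
  proof -
    have "((K \<circ> (\<lambda>t. (r t)\<^sup>2)) has_real_derivative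
        k (sqrt ((r t)\<^sup>2)) * (2 * r t * (R / 2 * (- sin t)))) (at t within {0..pi})"
      by (intro DERIV_image_chain dr has_field_derivative_subset[OF dK]) (use r2 in auto)
    moreover have "- (k (sqrt ((r t)\<^sup>2)) * (2 * r t * (R / 2 * (- sin t)))) / R\<^sup>2 = g t"
    proof -
      have "sqrt ((r t)\<^sup>2) = r t" using r[of t] by simp
      \<comment> \<open>Naming the value \<open>k (r t)\<close> shields the argument of
        \<open>k\<close> when \<open>r\<close> is unfolded for the algebra.\<close>
      moreover obtain c where "k (r t) = c" by simp
      ultimately show ?thesis
        using R by (simp add: g_def) (simp add: r_def power2_eq_square field_simps)
    qed
    ultimately show ?thesis
      using DERIV_cdivide[OF DERIV_minus, of "K \<circ> (\<lambda>t. (r t)\<^sup>2)" _ t "{0..pi}" "R\<^sup>2"]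
      by (fastforce simp: comp_def)
  qed
  moreover have "continuous_on {0..pi} g"
    unfolding g_def using r
    by (intro continuous_intros continuous_on_compose2[OF k]) (auto simp: r_def intro!: continuous_intros)
  ultimately have "(\<lambda>U. \<Sum>u=1..U. pi / real U * g ((2 * real u - 1) / (2 * real U) * pi))
      \<longlonglongrightarrow> - K ((r pi)\<^sup>2) / R\<^sup>2 - (- K ((r 0)\<^sup>2) / R\<^sup>2)"
    by (intro midpoint_sums_tendsto) auto
  moreover
  have "pi / real U * g ((2 * real u - 1) / (2 * real U) * pi)
      = weight U u * k (R / 2 * (node U u + 1))" if "u \<in> {1..U}" for U u
  proof -
    define t where "t = (2 * real u - 1) / (2 * real U) * pi"
    \<comment> \<open>The angle lies between 0 and \<open>pi\<close>, where the sine is nonnegative,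
      so the square root in the weight is \<open>sin t\<close> without absolute value.\<close>
    have le: "(2 * real u - 1) / (2 * real U) \<le> 1" and ge: "0 \<le> (2 * real u - 1) / (2 * real U)"
      using that by (auto simp: field_simps)
    have "0 \<le> t" "t \<le> pi"
      unfolding t_def using mult_nonneg_nonneg[OF ge pi_ge_zero] mult_left_le_one_le[OF pi_ge_zero ge le]
      by simp_all
    then have "sqrt (1 - (cos t)\<^sup>2) = sin t"
      by (simp add: sin_squared_eq[symmetric] sin_ge_zero)
    then show ?thesis unfolding weight_def node_def g_def r_def t_def[symmetric] by simp
  qed
  then have "(\<Sum>u=1..U. pi / real U * g ((2 * real u - 1) / (2 * real U) * pi))
      = (\<Sum>u=1..U. weight U u * k (R / 2 * (node U u + 1)))" for U
    by (intro sum.cong) auto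
  ultimately show ?thesis by (simp add: r_def K_def)
qed

text \<open>For \<open>x\<close> nonnegative this is the distribution function of one unordered
  gain: the squared distance \<open>s\<close> is uniform on \<open>{0..R\<^sup>2}\<close>, and given
  \<open>s\<close> the gain is exponential. Taking \<open>s\<close> rather than the distance as
  variable makes the density constant.\<close>

definition user_cdf :: "real \<Rightarrow> real \<Rightarrow> real \<Rightarrow> real \<Rightarrow> real" where
  "user_cdf \<eta> \<alpha> R x = integral {0..R\<^sup>2} (\<lambda>s. 1 - exp (- (x * (1 + sqrt s powr \<alpha>) / \<eta>))) / R\<^sup>2"

section \<open>Limits of the quadrature sums in the asymptotic expression\<close>

lemma quadrature_exp_tendsto:
  assumes "R > 0" "\<alpha> > 0"
  shows "(\<lambda>U. \<Sum>u=1..U. weight U u * (1 - exp (- (x * path_loss R \<alpha> U u / \<eta>)))) \<longlonglongrightarrow> user_cdf \<eta> \<alpha> R x"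
proof -
  have "continuous_on {0..R} (\<lambda>r. 1 - exp (- (x * (1 + r powr \<alpha>) / \<eta>)))"
    using assms by (cases "\<eta> = 0") (auto intro!: continuous_intros continuous_on_powr')
  from quadrature_tendsto[OF \<open>R > 0\<close> this] show ?thesis
    by (simp add: user_cdf_def path_loss_def)
qed

text \<open>The limit is a constant multiple of \<open>x\<close>; with \<open>x\<close> of order
  \<open>1 / \<rho>\<close> this makes the two leading terms vanish at high SNR.\<close>

lemma quadrature_linear_tendsto:
  assumes "R > 0" "\<alpha> > 0"
  shows "(\<lambda>U. \<Sum>u=1..U. weight U u * (x * path_loss R \<alpha> U u / \<eta>))
    \<longlonglongrightarrow> x * (integral {0..R\<^sup>2} (\<lambda>s. 1 + sqrt s powr \<alpha>) / R\<^sup>2 / \<eta>)"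
proof -
  have "continuous_on {0..R} (\<lambda>r. 1 + r powr \<alpha>)"
    using assms by (auto intro!: continuous_intros continuous_on_powr')
  from tendsto_mult_left[OF quadrature_tendsto[OF \<open>R > 0\<close> this], of "x / \<eta>"] show ?thesis
    by (simp add: path_loss_def sum_distrib_left mult_ac)
qed

text \<open>A pointwise limit of the quadrature sums, which are plainly measurable; no argument
  about parameter integrals is needed.\<close>

lemma borel_measurable_user_cdf [measurable]:
  assumes "R > 0" "\<alpha> > 0"
  shows "user_cdf \<eta> \<alpha> R \<in> borel_measurable borel"
  by (rule borel_measurable_LIMSEQ_real[OF quadrature_exp_tendsto[OF assms]]) measurable

lemma user_cdf_0: "user_cdf \<eta> \<alpha> R 0 = 0"
  by (simp add: user_cdf_def)

text \<open>The integrand is smallest at \<open>s = 0\<close>, where it equals the positive number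
  \<open>1 - exp (- (x / \<eta>))\<close>.\<close>

lemma user_cdf_pos:
  assumes "R > 0" "\<alpha> > 0" "\<eta> > 0" "x > 0"
  shows "0 < user_cdf \<eta> \<alpha> R x"
proof -
  let ?f = "\<lambda>s. 1 - exp (- (x * (1 + sqrt s powr \<alpha>) / \<eta>))"
  have "continuous_on {0..R\<^sup>2} ?f"
    using assms by (auto intro!: continuous_intros continuous_on_powr')
  then have "?f integrable_on {0..R\<^sup>2}" by (rule integrable_continuous_interval)
  then have "integral {0..R\<^sup>2} (\<lambda>s. 1 - exp (- (x / \<eta>))) \<le> integral {0..R\<^sup>2} ?f"
    using assms by (intro integral_le) (auto simp: field_simps)
  moreover have "0 < integral {0..R\<^sup>2} (\<lambda>s. 1 - exp (- (x / \<eta>)))"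
    using assms by simp
  ultimately have "0 < integral {0..R\<^sup>2} ?f" by linarith
  then show ?thesis using assms by (simp add: user_cdf_def)
qed

text \<open>Up to the factor \<open>\<Omega>\<close> the function is the exponential density of rate
  \<open>1 / \<Omega>\<close>, which has total mass 1.\<close>

lemma integrable_exp_halfline:
  assumes "\<Omega> > 0"
  shows "integrable lborel (\<lambda>y. indicator {0..} y * exp (- y / \<Omega>) :: real)"
proof -
  have "prob_space (density lborel (exponential_density (1 / \<Omega>)))"
    using assms by (intro prob_space_exponential_density) simp
  from prob_space.emeasure_space_1[OF this]
  have "(\<integral>\<^sup>+y. ennreal (exponential_density (1 / \<Omega>) y) \<partial>lborel) = 1"
    by (simp add: emeasure_density)
  then have "integrable lborel (exponential_density (1 / \<Omega>))"
    using assms by (intro integrableI_nonneg) (auto intro!: AE_I2 exponential_density_nonneg)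
  then have "integrable lborel (\<lambda>y. \<Omega> * exponential_density (1 / \<Omega>) y)" by simp
  also have "(\<lambda>y. \<Omega> * exponential_density (1 / \<Omega>) y) = (\<lambda>y. indicator {0..} y * exp (- y / \<Omega>))"
    using assms by (auto simp: exponential_density_def fun_eq_iff split: split_indicator)
  finally show ?thesis .
qed

text \<open>The limit passes through the integral by dominated convergence: the quadrature sums are
  bounded by \<open>pi\<close> for every \<open>U\<close>, so
  \<open>exp (- y / \<Omega>) * pi ^ j\<close> is an integrable majorant on the half-line.\<close>

lemma alf_asymptotic_tendsto:
  assumes pars: "R > 0" "\<alpha> > 0" "\<eta> > 0" "\<Omega> > 0" "\<theta> \<ge> 0"
  shows "alf_asymptotic M n \<eta> \<alpha> R \<Omega> \<zeta> \<tau> \<theta> \<longlonglongrightarrow>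
     fact M / (fact (M - n) * fact n) * (\<zeta> * (integral {0..R\<^sup>2} (\<lambda>s. 1 + sqrt s powr \<alpha>) / R\<^sup>2 / \<eta>)) ^ n
     - fact M / (fact (M - n) * fact n) * (\<tau> * (integral {0..R\<^sup>2} (\<lambda>s. 1 + sqrt s powr \<alpha>) / R\<^sup>2 / \<eta>)) ^ n
     + fact M / (fact (M - n) * fact (n - 1)) / \<Omega> *
       (\<Sum>p=0..M - n. real ((M - n) choose p) * ((-1) ^ p / real (n + p)) *
         (LBINT y:{0..}. exp (- y / \<Omega>) * user_cdf \<eta> \<alpha> R (y * \<theta>) ^ (n + p)))"
proof -
  define q where "q U x = (\<Sum>u=1..U. weight U u * (1 - exp (- (x * path_loss R \<alpha> U u / \<eta>))))" for U x
  have q: "(\<lambda>U. q U x) \<longlonglongrightarrow> user_cdf \<eta> \<alpha> R x" for x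
    unfolding q_def using pars by (intro quadrature_exp_tendsto)
  have [measurable]: "q U \<in> borel_measurable borel" for U unfolding q_def by measurable
  have [measurable]: "user_cdf \<eta> \<alpha> R \<in> borel_measurable borel"
    using pars by (intro borel_measurable_user_cdf)
  have q_bound: "\<bar>q U x\<bar> \<le> pi" if "x \<ge> 0" for U x
  proof -
    have "0 \<le> 1 - exp (- (x * path_loss R \<alpha> U u / \<eta>)) \<and> 1 - exp (- (x * path_loss R \<alpha> U u / \<eta>)) \<le> 1" for u
      using that pars by (auto simp: path_loss_def)
    then have "0 \<le> q U x" "q U x \<le> (\<Sum>u=1..U. weight U u)"
      unfolding q_def by (auto intro!: sum_nonneg sum_mono mult_nonneg_nonneg weight_nonneg mult_left_le)
    then show ?thesis using sum_weight_le[of U] by simp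
  qed
  have "(\<lambda>U. LBINT y:{0..}. exp (- y / \<Omega>) * q U (y * \<theta>) ^ j)
      \<longlonglongrightarrow> (LBINT y:{0..}. exp (- y / \<Omega>) * user_cdf \<eta> \<alpha> R (y * \<theta>) ^ j)" for j
    unfolding set_lebesgue_integral_def
  proof (rule integral_dominated_convergence)
    show "integrable lborel (\<lambda>y. indicator {0..} y * exp (- y / \<Omega>) * pi ^ j)"
      using integrable_exp_halfline[OF \<open>\<Omega> > 0\<close>] by simp
    show "AE y in lborel. (\<lambda>U. indicator {0..} y *\<^sub>R (exp (- y / \<Omega>) * q U (y * \<theta>) ^ j))
        \<longlonglongrightarrow> indicator {0..} y *\<^sub>R (exp (- y / \<Omega>) * user_cdf \<eta> \<alpha> R (y * \<theta>) ^ j)"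
      by (intro AE_I2 tendsto_intros q)
    show "AE y in lborel. norm (indicator {0..} y *\<^sub>R (exp (- y / \<Omega>) * q U (y * \<theta>) ^ j))
        \<le> indicator {0..} y * exp (- y / \<Omega>) * pi ^ j" for U
      using q_bound[of "y * \<theta>" for y] pars
      by (intro AE_I2) (auto simp: abs_mult power_abs intro!: power_mono mult_left_mono split: split_indicator)
  qed measurable
  then have "(\<lambda>U. fact M / (fact (M - n) * fact n) * (\<Sum>u=1..U. weight U u * (\<zeta> * path_loss R \<alpha> U u / \<eta>)) ^ n
     - fact M / (fact (M - n) * fact n) * (\<Sum>u=1..U. weight U u * (\<tau> * path_loss R \<alpha> U u / \<eta>)) ^ n
     + fact M / (fact (M - n) * fact (n - 1)) / \<Omega> *
       (\<Sum>p=0..M - n. real ((M - n) choose p) * ((-1) ^ p / real (n + p)) *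
         (LBINT y:{0..}. exp (- y / \<Omega>) * q U (y * \<theta>) ^ (n + p)))) \<longlonglongrightarrow>
     fact M / (fact (M - n) * fact n) * (\<zeta> * (integral {0..R\<^sup>2} (\<lambda>s. 1 + sqrt s powr \<alpha>) / R\<^sup>2 / \<eta>)) ^ n
     - fact M / (fact (M - n) * fact n) * (\<tau> * (integral {0..R\<^sup>2} (\<lambda>s. 1 + sqrt s powr \<alpha>) / R\<^sup>2 / \<eta>)) ^ n
     + fact M / (fact (M - n) * fact (n - 1)) / \<Omega> *
       (\<Sum>p=0..M - n. real ((M - n) choose p) * ((-1) ^ p / real (n + p)) *
         (LBINT y:{0..}. exp (- y / \<Omega>) * user_cdf \<eta> \<alpha> R (y * \<theta>) ^ (n + p)))"
    by (intro tendsto_intros quadrature_linear_tendsto pars)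
  then show ?thesis by (simp only: alf_asymptotic_def[abs_def] q_def)
qed


section \<open>Squared moduli and conditioning\<close>

text \<open>Both measures are compared on the half-lines \<open>{..x}\<close>, an
  intersection-stable generator: for \<open>x\<close> nonnegative the preimage is a disc of radius
  \<open>sqrt x\<close>, with area \<open>pi * x\<close>.\<close>

lemma distr_lborel_cmod_power2:
  "distr lborel borel (\<lambda>z::complex. (cmod z)\<^sup>2) = density lborel (\<lambda>s. ennreal (pi * indicator {0..} s))"
    (is "?M = ?N")
proof (rule measure_eqI_generator_eq[where E = "range atMost" and \<Omega> = UNIV and A = "\<lambda>i. {..real i}"])
  have M: "emeasure ?M {..x} = (if 0 \<le> x then ennreal (pi * x) else 0)" for x
  proof -
    have "(cmod z)\<^sup>2 \<le> x \<longleftrightarrow> 0 \<le> x \<and> cmod z \<le> sqrt x" for z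
      using real_sqrt_le_iff[of "(cmod z)\<^sup>2" x] order_trans[OF zero_le_power2] by auto
    then have "(\<lambda>z::complex. (cmod z)\<^sup>2) -` {..x} = (if 0 \<le> x then cball 0 (sqrt x) else {})"
      by auto
    then show ?thesis
      by (auto simp: emeasure_distr emeasure_cball unit_ball_vol_2 ennreal_mult' mult.commute)
  qed
  have N: "emeasure ?N {..x} = (if 0 \<le> x then ennreal (pi * x) else 0)" for x
  proof -
    have "emeasure ?N {..x} = (\<integral>\<^sup>+s. ennreal pi * indicator {0..x} s \<partial>lborel)"
      by (subst emeasure_density) (auto intro!: nn_integral_cong split: split_indicator)
    also have "\<dots> = (if 0 \<le> x then ennreal (pi * x) else 0)"
      by (subst nn_integral_cmult_indicator) (auto simp: ennreal_mult')
    finally show ?thesis .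
  qed
  show "emeasure ?M X = emeasure ?N X" if "X \<in> range atMost" for X
    using that M N by auto
  show "emeasure ?M {..real i} \<noteq> \<infinity>" for i using M by simp
  show "Int_stable (range (atMost :: real \<Rightarrow> real set))" by (auto simp: Int_stable_def)
  show "(\<Union>i. {..real i}) = UNIV" using real_arch_simple by auto
qed (auto simp: borel_eq_atMost)

text \<open>For a rotation-invariant density only the image of Lebesgue measure under the squared
  modulus matters. This serves the Gaussian coefficients and the uniform positions alike.\<close>

lemma distributed_cmod_power2:
  assumes X: "distributed P lborel X (\<lambda>z. ennreal (f ((cmod z)\<^sup>2)))"
    and [measurable]: "f \<in> borel_measurable borel" and f: "\<And>s. 0 \<le> f s"
  shows "distributed P lborel (\<lambda>\<omega>. (cmod (X \<omega>))\<^sup>2) (\<lambda>s. ennreal (pi * f s * indicator {0..} s))"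
  unfolding distributed_def
proof (intro conjI)
  have [measurable]: "X \<in> borel_measurable P" using distributed_measurable[OF X] by simp
  show "(\<lambda>\<omega>. (cmod (X \<omega>))\<^sup>2) \<in> P \<rightarrow>\<^sub>M lborel" by simp
  show "(\<lambda>s. ennreal (pi * f s * indicator {0..} s)) \<in> borel_measurable lborel" by measurable
  show "distr P lborel (\<lambda>\<omega>. (cmod (X \<omega>))\<^sup>2) = density lborel (\<lambda>s. ennreal (pi * f s * indicator {0..} s))"
  proof (rule measure_eqI)
    fix A :: "real set" assume "A \<in> sets (distr P lborel (\<lambda>\<omega>. (cmod (X \<omega>))\<^sup>2))"
    then have A[measurable]: "A \<in> sets borel" by simp
    have "emeasure (distr P lborel (\<lambda>\<omega>. (cmod (X \<omega>))\<^sup>2)) A = (\<integral>\<^sup>+\<omega>. indicator A ((cmod (X \<omega>))\<^sup>2) \<partial>P)"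
      by (subst emeasure_distr) (auto simp flip: nn_integral_indicator intro!: nn_integral_cong split: split_indicator)
    also have "\<dots> = (\<integral>\<^sup>+z. ennreal (f ((cmod z)\<^sup>2)) * indicator A ((cmod z)\<^sup>2) \<partial>lborel)"
      by (subst distributed_nn_integral[OF X]) auto
    also have "\<dots> = (\<integral>\<^sup>+s. ennreal (f s) * indicator A s \<partial>distr lborel borel (\<lambda>z::complex. (cmod z)\<^sup>2))"
      by (subst nn_integral_distr) auto
    also have "\<dots> = (\<integral>\<^sup>+s. ennreal (pi * f s * indicator {0..} s) * indicator A s \<partial>lborel)"
      unfolding distr_lborel_cmod_power2
      by (subst nn_integral_density)
         (auto intro!: nn_integral_cong simp: ennreal_mult' f mult_ac split: split_indicator)
    finally show "emeasure (distr P lborel (\<lambda>\<omega>. (cmod (X \<omega>))\<^sup>2)) A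
        = emeasure (density lborel (\<lambda>s. ennreal (pi * f s * indicator {0..} s))) A"
      by (subst (asm) emeasure_density[symmetric]) auto
  qed simp
qed

text \<open>Conditioning on \<open>Y\<close> by Fubini for the product law. Only \<open>Y\<close>
  has to possess a density, so that \<open>X\<close> may be the order statistic, whose density is
  never computed.\<close>

lemma (in prob_space) prob_indep_distributed:
  fixes f :: "real \<Rightarrow> real"
  assumes ind: "indep_var borel X borel Y" and Y: "distributed M lborel Y f"
    and f: "\<And>y. 0 \<le> f y" and A[measurable]: "Measurable.pred (borel \<Otimes>\<^sub>M borel) (case_prod A)"
  shows "prob {\<omega>\<in>space M. A (X \<omega>) (Y \<omega>)} = (LINT y|lborel. f y * prob {\<omega>\<in>space M. A (X \<omega>) y})"
proof -
  have [measurable]: "X \<in> borel_measurable M" "Y \<in> borel_measurable M"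
    using ind by (auto dest: indep_var_rv1 indep_var_rv2)
  have [measurable]: "{(x, y). A x y} \<in> sets (borel \<Otimes>\<^sub>M borel)"
    using A by (simp add: pred_def space_pair_measure)
  interpret X: prob_space "distr M borel X" by (rule prob_space_distr) simp
  interpret Y: prob_space "distr M borel Y" by (rule prob_space_distr) simp
  interpret XY: pair_prob_space "distr M borel X" "distr M borel Y" ..
  have [measurable]: "Measurable.pred borel (\<lambda>x. A x y)" for y
    using measurable_compose[OF _ A, of "\<lambda>x. (x, y)" borel] by simp
  have sect: "prob {\<omega>\<in>space M. A (X \<omega>) y} = (LINT x|distr M borel X. indicator {x. A x y} x)" for y
  proof -
    have "(LINT x|distr M borel X. indicator {x. A x y} x) = measure (distr M borel X) {x. A x y}"
      by simp
    also have "\<dots> = prob {\<omega>\<in>space M. A (X \<omega>) y}"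
      by (subst measure_distr) (auto intro!: arg_cong[where f = prob])
    finally show ?thesis by simp
  qed
  \<comment> \<open>The section probability must be measurable in \<open>y\<close> before the
    integral over the law of \<open>Y\<close> can be rewritten with its density.\<close>
  have [measurable]: "(\<lambda>y. LINT x|distr M borel X. indicator {x. A x y} x :: real) \<in> borel_measurable borel"
  proof (rule X.borel_measurable_lebesgue_integral)
    have "(\<lambda>(y, x). indicator {x. A x y} x :: real) = (\<lambda>z. indicator {z. case_prod A z} (snd z, fst z))"
      by (auto simp: fun_eq_iff split: split_indicator)
    also have "\<dots> \<in> borel_measurable (borel \<Otimes>\<^sub>M distr M borel X)"
      by measurable
    finally show "(\<lambda>(y, x). indicator {x. A x y} x :: real) \<in> borel_measurable (borel \<Otimes>\<^sub>M distr M borel X)" .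
  qed
  have "prob {\<omega>\<in>space M. A (X \<omega>) (Y \<omega>)}
      = measure (distr M (borel \<Otimes>\<^sub>M borel) (\<lambda>\<omega>. (X \<omega>, Y \<omega>))) {(x, y). A x y}"
    by (subst measure_distr) (auto intro!: arg_cong[where f = prob])
  also have "\<dots> = measure (distr M borel X \<Otimes>\<^sub>M distr M borel Y) {(x, y). A x y}"
    using ind by (simp add: indep_var_distribution_eq)
  also have "\<dots> = (LINT z|(distr M borel X \<Otimes>\<^sub>M distr M borel Y). indicator {(x, y). A x y} z)"
    by (simp add: space_pair_measure)
  also have "\<dots> = (LINT y|distr M borel Y. LINT x|distr M borel X. indicator {(x, y). A x y} (x, y))"
    by (subst XY.integral_snd) (auto intro!: XY.P.integrable_const_bound[where B = 1])
  also have "\<dots> = (LINT y|distr M borel Y. LINT x|distr M borel X. indicator {x. A x y} x)"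
    by (simp add: indicator_def)
  also have "\<dots> = (LINT \<omega>|M. LINT x|distr M borel X. indicator {x. A x (Y \<omega>)} x)"
    by (subst integral_distr) auto
  also have "\<dots> = (LINT y|lborel. f y * (LINT x|distr M borel X. indicator {x. A x y} x))"
    by (subst distributed_integral[OF Y]) (auto simp: f)
  finally show ?thesis by (simp only: sect)
qed


section \<open>Order statistics\<close>

text \<open>In a sorted list the entries up to \<open>x\<close> form an initial segment, and index
  \<open>k\<close>, counted from 0, falls into it exactly when the segment is longer than
  \<open>k\<close>.\<close>

lemma nth_sorted_le_iff:
  fixes xs :: "'a :: linorder list"
  assumes "sorted xs" "k < length xs"
  shows "xs ! k \<le> x \<longleftrightarrow> k < length (filter (\<lambda>y. y \<le> x) xs)"
  using assms
proof (induction xs arbitrary: k)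
  case (Cons a xs)
  show ?case
  proof (cases "a \<le> x")
    case True
    then show ?thesis using Cons by (cases k) auto
  next
    case False
    then have "\<forall>y\<in>set (a # xs). \<not> y \<le> x" using Cons.prems by force
    moreover from this have "\<not> (a # xs) ! k \<le> x" using Cons.prems nth_mem by blast
    ultimately show ?thesis by (simp add: filter_empty_conv)
  qed
qed simp

text \<open>This removes sorting from the argument: events about the order statistic become events
  about a count.\<close>

lemma nth_sort_map_le_iff:
  fixes w :: "nat \<Rightarrow> 'a :: linorder"
  assumes "1 \<le> n" "n \<le> M"
  shows "sort (map w [1..<Suc M]) ! (n - 1) \<le> x \<longleftrightarrow> n \<le> card {i\<in>{1..M}. w i \<le> x}"
proof -
  have "sort (map w [1..<Suc M]) ! (n - 1) \<le> x
      \<longleftrightarrow> n - 1 < length (filter (\<lambda>y. y \<le> x) (sort (map w [1..<Suc M])))"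
    using assms by (intro nth_sorted_le_iff) auto
  also have "length (filter (\<lambda>y. y \<le> x) (sort (map w [1..<Suc M])))
      = length (filter (\<lambda>i. w i \<le> x) [1..<Suc M])"
    by (simp add: filter_sort filter_map comp_def del: upt_Suc)
  also have "\<dots> = card {i\<in>{1..M}. w i \<le> x}"
    by (subst distinct_length_filter) (auto intro!: arg_cong[where f = card])
  finally show ?thesis using assms by auto
qed

text \<open>
  Both sides vanish at \<open>0\<close> and have the same derivative, the derivative of the left-hand side
  being a telescoping sum.
\<close>

lemma binomial_tail_eq:
  assumes n: "1 \<le> n" "n \<le> M"
  shows "(\<Sum>k=n..M. real (M choose k) * x ^ k * (1 - x) ^ (M - k)) =
    fact M / (fact (M - n) * fact (n - 1)) *
      (\<Sum>p=0..M - n. real ((M - n) choose p) * ((-1) ^ p / real (n + p)) * x ^ (n + p))"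
    (is "?B x = ?c * ?S x")
proof -
  \<comment> \<open>The value 0 beyond \<open>M\<close> makes the last term of the telescoping sum,
    with index \<open>Suc M\<close>, vanish.\<close>
  define \<phi> where "\<phi> k = (if k \<le> M then fact M / (fact (M - k) * fact (k - 1)) else 0 :: real)" for k
  \<comment> \<open>For \<open>k\<close> from 1 to \<open>M\<close>, this is on the unit interval
    the density of the \<open>k\<close>-th smallest of \<open>M\<close> independent uniform
    variables.\<close>
  define t where "t k y = \<phi> k * (y ^ (k - 1) * (1 - y) ^ (M - k))" for k and y :: real
  have dB: "(?B has_real_derivative ?c * (y ^ (n - 1) * (1 - y) ^ (M - n))) (at y)" for y
  proof -
    have one: "((\<lambda>y. real (M choose k) * y ^ k * (1 - y) ^ (M - k)) has_real_derivative
        - (t (Suc k) y - t k y)) (at y)" if k: "k \<in> {n..M}" for k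
    proof -
      have k1: "k \<ge> 1" using k n by auto
      have c1: "real (M choose k) * real k = \<phi> k"
        using k k1 by (simp add: \<phi>_def binomial_fact fact_reduce[of k])
      have c2: "real (M choose k) * real (M - k) = \<phi> (Suc k)"
        using k by (auto simp: \<phi>_def binomial_fact fact_reduce[of "M-k"] le_less)
      have "real (M choose k) * (real k * y ^ (k - 1)) * (1 - y) ^ (M - k)
          - real (M choose k) * y ^ k * (real (M - k) * (1 - y) ^ (M - k - 1)) = - (t (Suc k) y - t k y)"
        unfolding t_def c1[symmetric] c2[symmetric] by (simp add: algebra_simps)
      moreover have "((\<lambda>y. real (M choose k) * y ^ k * (1 - y) ^ (M - k)) has_real_derivative
          (real (M choose k) * (real k * y ^ (k - 1)) * (1 - y) ^ (M - k)
          - real (M choose k) * y ^ k * (real (M - k) * (1 - y) ^ (M - k - 1)))) (at y)"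
        by (auto intro!: derivative_eq_intros simp: algebra_simps)
      ultimately show ?thesis by simp
    qed
    have "(?B has_real_derivative (\<Sum>k=n..M. - (t (Suc k) y - t k y))) (at y)"
      by (intro DERIV_sum one)
    moreover have "(\<Sum>k=n..M. - (t (Suc k) y - t k y)) = t n y"
      using n by (simp only: sum_negf) (subst sum_Suc_diff, auto simp: t_def \<phi>_def)
    ultimately show ?thesis using n by (simp add: t_def \<phi>_def)
  qed
  have dS: "((\<lambda>x. ?c * ?S x) has_real_derivative ?c * (y ^ (n - 1) * (1 - y) ^ (M - n))) (at y)" for y
  proof -
    \<comment> \<open>Expanding this factor binomially turns the common derivative into monomials
      \<open>y ^ (n + p - 1)\<close>, whose antiderivatives carry the denominators
      \<open>n + p\<close>.\<close>
    have "(1 - y) ^ (M - n) = (\<Sum>p=0..M - n. real ((M - n) choose p) * (-1) ^ p * y ^ p)"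
      using binomial_ring[of "- y" 1 "M - n"] by (simp add: power_minus[of y] atMost_atLeast0 mult_ac)
    then have "y ^ (n - 1) * (1 - y) ^ (M - n)
        = (\<Sum>p=0..M - n. real ((M - n) choose p) * (-1) ^ p * y ^ (n + p - 1))"
      using n by (auto simp: sum_distrib_left power_add mult_ac intro!: sum.cong)
        (metis Nat.add_diff_assoc2 One_nat_def add.commute power_add)
    moreover have "(?S has_real_derivative
        (\<Sum>p=0..M - n. real ((M - n) choose p) * (-1) ^ p * y ^ (n + p - 1))) (at y)"
    proof (rule DERIV_sum)
      fix p
      show "((\<lambda>x. real ((M - n) choose p) * ((-1) ^ p / real (n + p)) * x ^ (n + p)) has_real_derivative
          real ((M - n) choose p) * (-1) ^ p * y ^ (n + p - 1)) (at y)"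
        using n by (auto intro!: derivative_eq_intros)
    qed
    ultimately show ?thesis by (simp only: DERIV_cmult)
  qed
  have "((\<lambda>x. ?B x - ?c * ?S x) has_real_derivative 0) (at y)" for y
    using DERIV_diff[OF dB dS] by simp
  then have "?B x - ?c * ?S x = ?B 0 - ?c * ?S 0" by (intro DERIV_isconst_all) auto
  also have "\<dots> = 0" using n by (auto intro!: sum.neutral)
  finally show ?thesis by simp
qed


lemma (in prob_space) prob_indep_pattern:
  fixes W :: "'i \<Rightarrow> 'a \<Rightarrow> real"
  assumes ind: "indep_vars (\<lambda>_. borel) W I" and I: "finite I" "S \<subseteq> I"
    and q: "\<And>i. i \<in> I \<Longrightarrow> prob {\<omega>\<in>space M. W i \<omega> \<le> x} = q"
  shows "prob {\<omega>\<in>space M. {i\<in>I. W i \<omega> \<le> x} = S} = q ^ card S * (1 - q) ^ (card I - card S)"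
\<comment> \<open>An intersection over the empty index set would be the whole type instead of
  \<open>space M\<close>, so that case is treated apart.\<close>
proof (cases "I = {}")
  case False
  \<comment> \<open>Choosing for each index the half-line or its complement writes the pattern event
    as an intersection of independent events.\<close>
  define B where "B i = (if i \<in> S then {..x} else {x<..})" for i
  have [measurable]: "W i \<in> borel_measurable M" if "i \<in> I" for i
    using ind that by (auto simp: indep_vars_def)
  have B: "prob (W i -` B i \<inter> space M) = (if i \<in> S then q else 1 - q)" if "i \<in> I" for i
  proof -
    have "prob (W i -` {..x} \<inter> space M) = q"
      using q[OF that] by (simp add: vimage_def Int_def conj_commute)
    moreover have "W i -` {x<..} \<inter> space M = space M - (W i -` {..x} \<inter> space M)" by auto
    moreover have "W i -` {..x} \<inter> space M \<in> events" using that by (auto intro: measurable_sets[where A = borel])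
    ultimately show ?thesis by (simp add: B_def prob_compl)
  qed
  have "{\<omega>\<in>space M. {i\<in>I. W i \<omega> \<le> x} = S} = (\<Inter>i\<in>I. W i -` B i \<inter> space M)"
    using False I by (auto simp: B_def not_le split: if_splits)
  also have "prob \<dots> = (\<Prod>i\<in>I. if i \<in> S then q else 1 - q)"
    using B by (subst indep_varsD_finite[OF ind]) (auto simp: False I B_def)
  also have "\<dots> = q ^ card S * (1 - q) ^ (card I - card S)"
  proof -
    have "I \<inter> S = S" "I \<inter> - S = I - S" using I by auto
    then show ?thesis
      using I finite_subset[OF I(2,1)] by (simp add: prod.If_cases card_Diff_subset)
  qed
  finally show ?thesis .
qed (use assms prob_space in auto)

text \<open>The event splits disjointly according to the exact set of indices below
  \<open>x\<close>; grouping these sets by cardinality produces the binomial coefficients.\<close>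

lemma (in prob_space) prob_count_le_ge:
  fixes W :: "'i \<Rightarrow> 'a \<Rightarrow> real"
  assumes ind: "indep_vars (\<lambda>_. borel) W I" and I: "finite I"
    and q: "\<And>i. i \<in> I \<Longrightarrow> prob {\<omega>\<in>space M. W i \<omega> \<le> x} = q"
  shows "prob {\<omega>\<in>space M. n \<le> card {i\<in>I. W i \<omega> \<le> x}}
    = (\<Sum>k=n..card I. real (card I choose k) * q ^ k * (1 - q) ^ (card I - k))"
proof -
  define E where "E S = {\<omega>\<in>space M. {i\<in>I. W i \<omega> \<le> x} = S}" for S
  define F where "F = {S. S \<subseteq> I \<and> n \<le> card S}"
  have [measurable]: "W i \<in> borel_measurable M" if "i \<in> I" for i
    using ind that by (auto simp: indep_vars_def)
  have E: "E S \<in> events" for S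
  proof -
    have "E S = (if S \<subseteq> I then {\<omega>\<in>space M. \<forall>i\<in>I. (W i \<omega> \<le> x) = (i \<in> S)} else {})"
      by (auto simp: E_def)
    moreover have "{\<omega>\<in>space M. \<forall>i\<in>I. (W i \<omega> \<le> x) = (i \<in> S)} \<in> events"
      using I by measurable
    ultimately show ?thesis by simp
  qed
  have F: "finite F" unfolding F_def using I by auto
  have "{\<omega>\<in>space M. n \<le> card {i\<in>I. W i \<omega> \<le> x}} = (\<Union>S\<in>F. E S)"
    by (auto simp: E_def F_def)
  also have "prob \<dots> = (\<Sum>S\<in>F. prob (E S))"
    using F E by (intro finite_measure_finite_Union) (auto simp: disjoint_family_on_def E_def)
  also have "\<dots> = (\<Sum>S\<in>F. q ^ card S * (1 - q) ^ (card I - card S))"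
    using prob_indep_pattern[OF ind I _ q] by (intro sum.cong) (auto simp: E_def F_def)
  also have "\<dots> = (\<Sum>k=n..card I. \<Sum>S\<in>{S\<in>F. card S = k}. q ^ card S * (1 - q) ^ (card I - card S))"
    using F I by (intro sum.group[symmetric]) (auto simp: F_def card_mono)
  also have "\<dots> = (\<Sum>k=n..card I. real (card I choose k) * q ^ k * (1 - q) ^ (card I - k))"
  proof (intro sum.cong refl)
    fix k assume "k \<in> {n..card I}"
    then have "{S\<in>F. card S = k} = {S. S \<subseteq> I \<and> card S = k}" by (auto simp: F_def)
    then show "(\<Sum>S\<in>{S\<in>F. card S = k}. q ^ card S * (1 - q) ^ (card I - card S))
        = real (card I choose k) * q ^ k * (1 - q) ^ (card I - k)"
      using n_subsets[OF I, of k] by simp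
  qed
  finally show ?thesis .
qed

text \<open>By the counting criterion each sublevel set is defined by a finite sum of indicators of
  the coordinates.\<close>

lemma measurable_nth_sort:
  assumes "1 \<le> n" "n \<le> M"
  shows "(\<lambda>w. sort (map w [1..<Suc M]) ! (n - 1)) \<in> borel_measurable (\<Pi>\<^sub>M i\<in>{1..M}. (borel :: real measure))"
proof -
  have "{w \<in> space (\<Pi>\<^sub>M i\<in>{1..M}. (borel :: real measure)). sort (map w [1..<Suc M]) ! (n - 1) \<le> x}
      \<in> sets (\<Pi>\<^sub>M i\<in>{1..M}. borel)" for x
  proof -
    have count: "real (card {i\<in>{1..M}. w i \<le> x}) = (\<Sum>i\<in>{1..M}. indicator {..x} (w i))" for w
      by (simp add: indicator_def sum.If_cases Int_def)
    have iff: "sort (map w [1..<Suc M]) ! (n - 1) \<le> x \<longleftrightarrow> real n \<le> (\<Sum>i\<in>{1..M}. indicator {..x} (w i))" for w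
      by (simp only: nth_sort_map_le_iff[OF assms] count[symmetric] of_nat_le_iff)
    show ?thesis unfolding iff by measurable
  qed
  then show ?thesis by (simp add: borel_measurable_iff_le del: upt_Suc)
qed


section \<open>Distribution of the channel gains\<close>

context noma_downlink begin

definition gain :: "real \<Rightarrow> real \<Rightarrow> nat \<Rightarrow> 'w \<Rightarrow> real" where
  "gain \<eta> \<alpha> i \<omega> = (cmod (channel_coeff \<eta> \<alpha> (pos i \<omega>) (h i \<omega>)))\<^sup>2"

lemma gain_eq:
  assumes "\<eta> > 0"
  shows "gain \<eta> \<alpha> i \<omega> = \<eta> * (cmod (h i \<omega>))\<^sup>2 / (1 + cmod (pos i \<omega>) powr \<alpha>)"
proof -
  have "0 \<le> 1 + cmod (pos i \<omega>) powr \<alpha>" by (simp add: add_nonneg_nonneg)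
  then show ?thesis using assms
    by (simp add: gain_def channel_coeff_def norm_divide norm_mult power_divide power_mult_distrib)
qed

text \<open>Index 0, which is no user, carries the residual interference. One family then yields
  both the independence of the gains among themselves and their joint independence of the
  residual.\<close>

lemma indep_gains:
  "indep_vars (\<lambda>_. borel) (\<lambda>i. if i = 0 then (\<lambda>\<omega>. (cmod (h\<^sub>I \<omega>))\<^sup>2) else gain \<eta> \<alpha> i) {0..M}"
proof -
  define X where "X s = (case s of Position i \<Rightarrow> pos i | Fading i \<Rightarrow> h i | Residual \<Rightarrow> h\<^sub>I)" for s
  \<comment> \<open>The sources are grouped into disjoint blocks, each member of the family
    depending on its own block only.\<close>
  define K where "K i = (if i = 0 then {Residual} else {Position i, Fading i})" for i
  define Y where "Y i w = (if i = 0 then (cmod (w Residual))\<^sup>2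
    else (cmod (channel_coeff \<eta> \<alpha> (w (Position i)) (w (Fading i))))\<^sup>2)" for i and w :: "source \<Rightarrow> complex"
  have "indep_vars (\<lambda>_. borel) X (Position ` {1..M} \<union> Fading ` {1..M} \<union> {Residual})"
    using independent by (simp add: X_def[abs_def])
  then have "indep_vars (\<lambda>i. \<Pi>\<^sub>M s\<in>K i. borel) (\<lambda>i \<omega>. restrict (\<lambda>s. X s \<omega>) (K i)) {0..M}"
    by (rule indep_vars_restrict) (auto simp: K_def disjoint_family_on_def)
  then have "indep_vars (\<lambda>_. borel) (\<lambda>i \<omega>. Y i (restrict (\<lambda>s. X s \<omega>) (K i))) {0..M}"
  proof (rule indep_vars_compose2)
    fix i assume "i \<in> {0..M}"
    show "Y i \<in> borel_measurable (\<Pi>\<^sub>M s\<in>K i. borel)"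
    proof (cases "i = 0")
      case True
      then have "(\<lambda>w. w Residual) \<in> borel_measurable (\<Pi>\<^sub>M s\<in>K i. (borel :: complex measure))"
        by (intro measurable_component_singleton) (simp add: K_def)
      then show ?thesis using True by (simp add: Y_def[abs_def])
    next
      case False
      then have [measurable]: "(\<lambda>w. w (Position i)) \<in> borel_measurable (\<Pi>\<^sub>M s\<in>K i. (borel :: complex measure))"
        "(\<lambda>w. w (Fading i)) \<in> borel_measurable (\<Pi>\<^sub>M s\<in>K i. (borel :: complex measure))"
        by (auto intro!: measurable_component_singleton simp: K_def)
      show ?thesis using False by (simp add: Y_def[abs_def] channel_coeff_def)
    qed
  qed
  then show ?thesis
    by (rule indep_vars_cong[THEN iffD1, rotated -1])
       (auto simp: Y_def X_def K_def gain_def fun_eq_iff)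
qed

lemma ordered_gain_eq: "ordered_gain M \<eta> \<alpha> pos h n \<omega> = sort (map (\<lambda>i. gain \<eta> \<alpha> i \<omega>) [1..<Suc M]) ! (n - 1)"
  by (simp add: ordered_gain_def gain_def)

text \<open>The order statistic is a function of the coordinates \<open>{1..M}\<close> and the
  residual gain of coordinate 0, which are disjoint blocks of an independent family.\<close>

lemma indep_ordered_gain_residual:
  assumes "1 \<le> n" "n \<le> M"
  shows "indep_var borel (ordered_gain M \<eta> \<alpha> pos h n) borel (\<lambda>\<omega>. (cmod (h\<^sub>I \<omega>))\<^sup>2)"
proof -
  let ?W = "\<lambda>i. if i = 0 then (\<lambda>\<omega>. (cmod (h\<^sub>I \<omega>))\<^sup>2) else gain \<eta> \<alpha> i"
  have "indep_var (\<Pi>\<^sub>M i\<in>{1..M}. borel) (\<lambda>\<omega>. restrict (\<lambda>i. ?W i \<omega>) {1..M})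
      (\<Pi>\<^sub>M i\<in>{0}. borel) (\<lambda>\<omega>. restrict (\<lambda>i. ?W i \<omega>) {0})"
    by (rule indep_var_restrict[OF indep_gains]) auto
  then have "indep_var borel ((\<lambda>w. sort (map w [1..<Suc M]) ! (n - 1)) \<circ> (\<lambda>\<omega>. restrict (\<lambda>i. ?W i \<omega>) {1..M}))
      borel ((\<lambda>w. w 0) \<circ> (\<lambda>\<omega>. restrict (\<lambda>i. ?W i \<omega>) {0}))"
    by (rule indep_var_compose) (intro measurable_nth_sort assms, simp)
  moreover have "(\<lambda>w. sort (map w [1..<Suc M]) ! (n - 1)) \<circ> (\<lambda>\<omega>. restrict (\<lambda>i. ?W i \<omega>) {1..M})
      = ordered_gain M \<eta> \<alpha> pos h n"
  proof
    fix \<omega>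
    have "map (restrict (\<lambda>i. ?W i \<omega>) {1..M}) [1..<Suc M] = map (\<lambda>i. gain \<eta> \<alpha> i \<omega>) [1..<Suc M]"
      by (intro map_cong) auto
    then show "((\<lambda>w. sort (map w [1..<Suc M]) ! (n - 1)) \<circ> (\<lambda>\<omega>. restrict (\<lambda>i. ?W i \<omega>) {1..M})) \<omega>
        = ordered_gain M \<eta> \<alpha> pos h n \<omega>"
      by (simp only: comp_def ordered_gain_eq)
  qed
  ultimately show ?thesis by (simp add: comp_def)
qed

text \<open>The area factor \<open>pi\<close> cancels against the normalisation of the Gaussian
  density, leaving an exponential law with mean \<open>\<Omega>\<^sub>I\<close>.\<close>

lemma residual_distributed:
  assumes "\<Omega>\<^sub>I > 0"
  shows "distributed P lborel (\<lambda>\<omega>. (cmod (h\<^sub>I \<omega>))\<^sup>2) (exponential_density (1 / \<Omega>\<^sub>I))"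
proof -
  have "distributed P lborel (\<lambda>\<omega>. (cmod (h\<^sub>I \<omega>))\<^sup>2)
      (\<lambda>s. ennreal (pi * (exp (- s / \<Omega>\<^sub>I) / (pi * \<Omega>\<^sub>I)) * indicator {0..} s))"
    using residual_gaussian assms unfolding complex_gaussian_density_def
    by (intro distributed_cmod_power2) auto
  also have "(\<lambda>s. ennreal (pi * (exp (- s / \<Omega>\<^sub>I) / (pi * \<Omega>\<^sub>I)) * indicator {0..} s))
      = exponential_density (1 / \<Omega>\<^sub>I)"
    by (auto simp: exponential_density_def fun_eq_iff split: split_indicator)
  finally show ?thesis .
qed

lemma fading_distributed:
  assumes "i \<in> {1..M}"
  shows "distributed P lborel (\<lambda>\<omega>. (cmod (h i \<omega>))\<^sup>2) (exponential_density 1)"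
proof -
  have "distributed P lborel (\<lambda>\<omega>. (cmod (h i \<omega>))\<^sup>2)
      (\<lambda>s. ennreal (pi * (exp (- s) / pi) * indicator {0..} s))"
    using fading_gaussian[OF assms] unfolding complex_gaussian_density_def
    by (intro distributed_cmod_power2) auto
  also have "(\<lambda>s. ennreal (pi * (exp (- s) / pi) * indicator {0..} s)) = exponential_density 1"
    by (auto simp: exponential_density_def fun_eq_iff split: split_indicator)
  finally show ?thesis .
qed

lemma squared_distance_distributed:
  assumes i: "i \<in> {1..M}" and R: "R\<^sub>D > 0"
  shows "distributed P lborel (\<lambda>\<omega>. (cmod (pos i \<omega>))\<^sup>2) (\<lambda>s. indicator {0..R\<^sub>D\<^sup>2} s / R\<^sub>D\<^sup>2)"
proof -
  have "indicator (cball 0 R\<^sub>D) x / measure lborel (cball (0::complex) R\<^sub>D)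
      = indicator {..R\<^sub>D\<^sup>2} ((cmod x)\<^sup>2) / (pi * R\<^sub>D\<^sup>2)" for x
    using R by (auto simp: content_cball unit_ball_vol_2 power2_le_iff_abs_le split: split_indicator)
  then have "distributed P lborel (\<lambda>\<omega>. (cmod (pos i \<omega>))\<^sup>2)
      (\<lambda>s. ennreal (pi * (indicator {..R\<^sub>D\<^sup>2} s / (pi * R\<^sub>D\<^sup>2)) * indicator {0..} s))"
    using pos_uniform[OF i] by (intro distributed_cmod_power2) auto
  also have "(\<lambda>s. ennreal (pi * (indicator {..R\<^sub>D\<^sup>2} s / (pi * R\<^sub>D\<^sup>2)) * indicator {0..} s))
      = (\<lambda>s. indicator {0..R\<^sub>D\<^sup>2} s / R\<^sub>D\<^sup>2)"
    by (auto simp: fun_eq_iff split: split_indicator)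
  finally show ?thesis .
qed

text \<open>Given the squared distance, the event bounds the exponential variable
  \<open>(cmod (h i \<omega>))\<^sup>2\<close>; averaging its distribution function over the uniform
  squared distance gives \<open>user_cdf\<close>.\<close>

lemma prob_gain_le:
  assumes i: "i \<in> {1..M}" and pars: "R\<^sub>D > 0" "\<eta> > 0" "\<alpha> > 0" and x: "0 \<le> x"
  shows "prob {\<omega>\<in>space P. gain \<eta> \<alpha> i \<omega> \<le> x} = user_cdf \<eta> \<alpha> R\<^sub>D x"
proof -
  have "indep_var (\<Pi>\<^sub>M s\<in>{Fading i}. borel)
      (\<lambda>\<omega>. restrict (\<lambda>s. (case s of Position i \<Rightarrow> pos i | Fading i \<Rightarrow> h i | Residual \<Rightarrow> h\<^sub>I) \<omega>) {Fading i})
      (\<Pi>\<^sub>M s\<in>{Position i}. borel)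
      (\<lambda>\<omega>. restrict (\<lambda>s. (case s of Position i \<Rightarrow> pos i | Fading i \<Rightarrow> h i | Residual \<Rightarrow> h\<^sub>I) \<omega>) {Position i})"
    by (rule indep_var_restrict[OF independent]) (use i in auto)
  from indep_var_compose[OF this, of "\<lambda>w. (cmod (w (Fading i)))\<^sup>2" borel "\<lambda>w. (cmod (w (Position i)))\<^sup>2" borel]
  have ind: "indep_var borel (\<lambda>\<omega>. (cmod (h i \<omega>))\<^sup>2) borel (\<lambda>\<omega>. (cmod (pos i \<omega>))\<^sup>2)"
    by (simp add: comp_def)
  have tail: "prob {\<omega>\<in>space P. (cmod (h i \<omega>))\<^sup>2 \<le> x * (1 + sqrt s powr \<alpha>) / \<eta>}
      = 1 - exp (- (x * (1 + sqrt s powr \<alpha>) / \<eta>))" for s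
    using exponential_distributedD_le[OF fading_distributed[OF i], of "x * (1 + sqrt s powr \<alpha>) / \<eta>"] x pars
    by (simp add: add_nonneg_nonneg)
  \<comment> \<open>Conditioning yields a Lebesgue integral, while \<open>user_cdf\<close> uses the
    gauge integral; continuity makes the two agree.\<close>
  have "continuous_on {0..R\<^sub>D\<^sup>2} (\<lambda>s. 1 - exp (- (x * (1 + sqrt s powr \<alpha>) / \<eta>)))"
    using pars by (auto intro!: continuous_intros continuous_on_powr')
  then have "set_integrable lborel {0..R\<^sub>D\<^sup>2} (\<lambda>s. 1 - exp (- (x * (1 + sqrt s powr \<alpha>) / \<eta>)))"
    by (rule borel_integrable_atLeastAtMost')
  then have hk: "(LBINT s:{0..R\<^sub>D\<^sup>2}. 1 - exp (- (x * (1 + sqrt s powr \<alpha>) / \<eta>)))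
      = integral {0..R\<^sub>D\<^sup>2} (\<lambda>s. 1 - exp (- (x * (1 + sqrt s powr \<alpha>) / \<eta>)))"
    by (rule set_borel_integral_eq_integral)
  have "gain \<eta> \<alpha> i \<omega> \<le> x \<longleftrightarrow>
      (cmod (h i \<omega>))\<^sup>2 \<le> x * (1 + sqrt ((cmod (pos i \<omega>))\<^sup>2) powr \<alpha>) / \<eta>" for \<omega>
  proof -
    have "0 < 1 + cmod (pos i \<omega>) powr \<alpha>" by (simp add: add_pos_nonneg)
    then show ?thesis using pars by (simp add: gain_eq field_simps)
  qed
  then have "prob {\<omega>\<in>space P. gain \<eta> \<alpha> i \<omega> \<le> x} = prob {\<omega>\<in>space P.
      (cmod (h i \<omega>))\<^sup>2 \<le> x * (1 + sqrt ((cmod (pos i \<omega>))\<^sup>2) powr \<alpha>) / \<eta>}" by simp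
  also have "\<dots> = (LINT s|lborel. indicator {0..R\<^sub>D\<^sup>2} s / R\<^sub>D\<^sup>2 * (1 - exp (- (x * (1 + sqrt s powr \<alpha>) / \<eta>))))"
    unfolding tail[symmetric]
    by (rule prob_indep_distributed[OF ind squared_distance_distributed[OF i pars(1)]]) auto
  also have "\<dots> = (LBINT s:{0..R\<^sub>D\<^sup>2}. 1 - exp (- (x * (1 + sqrt s powr \<alpha>) / \<eta>))) / R\<^sub>D\<^sup>2"
    by (simp add: set_lebesgue_integral_def)
  finally show ?thesis by (simp only: hk user_cdf_def)
qed

section \<open>Law of the ordered gain and its comparison with the residual gain\<close>

lemma random_variable_ordered_gain:
  assumes "1 \<le> n" "n \<le> M"
  shows "random_variable borel (ordered_gain M \<eta> \<alpha> pos h n)"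
  using indep_var_rv1[OF indep_ordered_gain_residual[OF assms]] .

lemma prob_ordered_gain_le:
  assumes n: "1 \<le> n" "n \<le> M" and pars: "R\<^sub>D > 0" "\<eta> > 0" "\<alpha> > 0" "0 \<le> x"
  shows "prob {\<omega>\<in>space P. ordered_gain M \<eta> \<alpha> pos h n \<omega> \<le> x} =
    (\<Sum>k=n..M. real (M choose k) * user_cdf \<eta> \<alpha> R\<^sub>D x ^ k * (1 - user_cdf \<eta> \<alpha> R\<^sub>D x) ^ (M - k))"
proof -
  have "indep_vars (\<lambda>_. borel) (\<lambda>i. if i = 0 then (\<lambda>\<omega>. (cmod (h\<^sub>I \<omega>))\<^sup>2) else gain \<eta> \<alpha> i) {1..M}"
    by (rule indep_vars_subset[OF indep_gains]) auto
  then have ind: "indep_vars (\<lambda>_. borel) (gain \<eta> \<alpha>) {1..M}"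
    by (rule indep_vars_cong[THEN iffD1, rotated -1]) auto
  show ?thesis
    using prob_count_le_ge[OF ind _ prob_gain_le[OF _ pars], of n]
    unfolding ordered_gain_eq nth_sort_map_le_iff[OF n] by simp
qed

text \<open>At gain 0 the SINR for the signal of \<open>m\<close> stays 0 at every SNR, so this case
  has to be excluded as a null event.\<close>

lemma AE_ordered_gain_pos:
  assumes n: "1 \<le> n" "n \<le> M" and pars: "R\<^sub>D > 0" "\<eta> > 0" "\<alpha> > 0"
  shows "AE \<omega> in P. 0 < ordered_gain M \<eta> \<alpha> pos h n \<omega>"
proof -
  have [measurable]: "random_variable borel (ordered_gain M \<eta> \<alpha> pos h n)"
    using n by (rule random_variable_ordered_gain)
  have "prob {\<omega>\<in>space P. ordered_gain M \<eta> \<alpha> pos h n \<omega> \<le> 0} = 0"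
    unfolding prob_ordered_gain_le[OF n pars order_refl] user_cdf_0
    using n by (intro sum.neutral) auto
  then have "AE \<omega> in P. \<not> ordered_gain M \<eta> \<alpha> pos h n \<omega> \<le> 0"
    by (subst (asm) prob_eq_0) auto
  then show ?thesis by (simp add: not_le)
qed

text \<open>The bounds are read off from the probability that the first user has gain at most
  \<open>x\<close>.\<close>

lemma user_cdf_in_unit:
  assumes "1 \<le> M" "R\<^sub>D > 0" "\<eta> > 0" "\<alpha> > 0" "0 \<le> x"
  shows "0 \<le> user_cdf \<eta> \<alpha> R\<^sub>D x" "user_cdf \<eta> \<alpha> R\<^sub>D x \<le> 1"
  using prob_gain_le[of 1 \<eta> \<alpha> x] assms by (auto simp flip: prob_gain_le[of 1])

lemma prob_ordered_gain_le_residual: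
  assumes n: "1 \<le> n" "n \<le> M" and pars: "R\<^sub>D > 0" "\<eta> > 0" "\<alpha> > 0" and \<Omega>: "\<Omega>\<^sub>I > 0" and \<theta>: "\<theta> \<ge> 0"
  shows "prob {\<omega>\<in>space P. ordered_gain M \<eta> \<alpha> pos h n \<omega> \<le> \<theta> * (cmod (h\<^sub>I \<omega>))\<^sup>2} =
    fact M / (fact (M - n) * fact (n - 1)) / \<Omega>\<^sub>I *
       (\<Sum>p=0..M - n. real ((M - n) choose p) * ((-1) ^ p / real (n + p)) *
         (LBINT y:{0..}. exp (- y / \<Omega>\<^sub>I) * user_cdf \<eta> \<alpha> R\<^sub>D (y * \<theta>) ^ (n + p)))"
proof -
  let ?c = "fact M / (fact (M - n) * fact (n - 1)) :: real"
  let ?w = "\<lambda>p. real ((M - n) choose p) * ((-1) ^ p / real (n + p))"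
  have [measurable]: "user_cdf \<eta> \<alpha> R\<^sub>D \<in> borel_measurable borel"
    using pars by (intro borel_measurable_user_cdf)
  have int: "integrable lborel (\<lambda>y. indicator {0..} y * (exp (- y / \<Omega>\<^sub>I) * user_cdf \<eta> \<alpha> R\<^sub>D (y * \<theta>) ^ j))" for j
  proof (rule Bochner_Integration.integrable_bound[OF integrable_exp_halfline[OF \<Omega>]])
    have "user_cdf \<eta> \<alpha> R\<^sub>D (y * \<theta>) ^ j \<le> 1 \<and> 0 \<le> user_cdf \<eta> \<alpha> R\<^sub>D (y * \<theta>) ^ j" if "y \<ge> 0" for y
      using user_cdf_in_unit[of \<eta> \<alpha> "y * \<theta>"] n pars \<theta> that by (auto intro: power_le_one)
    then show "AE y in lborel. norm (indicator {0..} y * (exp (- y / \<Omega>\<^sub>I) * user_cdf \<eta> \<alpha> R\<^sub>D (y * \<theta>) ^ j))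
        \<le> norm (indicator {0..} y * exp (- y / \<Omega>\<^sub>I))"
      by (intro AE_I2) (auto split: split_indicator)
  qed measurable
  have "prob {\<omega>\<in>space P. ordered_gain M \<eta> \<alpha> pos h n \<omega> \<le> \<theta> * (cmod (h\<^sub>I \<omega>))\<^sup>2}
      = (LINT y|lborel. exponential_density (1 / \<Omega>\<^sub>I) y * prob {\<omega>\<in>space P. ordered_gain M \<eta> \<alpha> pos h n \<omega> \<le> \<theta> * y})"
    using \<Omega> by (intro prob_indep_distributed[OF indep_ordered_gain_residual[OF n] residual_distributed[OF \<Omega>]])
      (auto intro: exponential_density_nonneg)
  also have "\<dots> = (LINT y|lborel. (\<Sum>p=0..M - n. ?c / \<Omega>\<^sub>I * ?w p *
      (indicator {0..} y * (exp (- y / \<Omega>\<^sub>I) * user_cdf \<eta> \<alpha> R\<^sub>D (y * \<theta>) ^ (n + p)))))"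
  proof (intro Bochner_Integration.integral_cong refl)
    fix y
    show "exponential_density (1 / \<Omega>\<^sub>I) y * prob {\<omega>\<in>space P. ordered_gain M \<eta> \<alpha> pos h n \<omega> \<le> \<theta> * y}
      = (\<Sum>p=0..M - n. ?c / \<Omega>\<^sub>I * ?w p *
          (indicator {0..} y * (exp (- y / \<Omega>\<^sub>I) * user_cdf \<eta> \<alpha> R\<^sub>D (y * \<theta>) ^ (n + p))))"
    \<comment> \<open>For negative \<open>y\<close> the exponential density is 0; otherwise the
      threshold is nonnegative and the binomial tail formula applies.\<close>
    proof (cases "y < 0")
      case False
      then have "0 \<le> \<theta> * y" using \<theta> by simp
      from prob_ordered_gain_le[OF n pars this]
      have "prob {\<omega>\<in>space P. ordered_gain M \<eta> \<alpha> pos h n \<omega> \<le> \<theta> * y}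
          = ?c * (\<Sum>p=0..M - n. ?w p * user_cdf \<eta> \<alpha> R\<^sub>D (y * \<theta>) ^ (n + p))"
        by (simp only: binomial_tail_eq[OF n] mult.commute[of \<theta> y])
      then show ?thesis using False
        by (simp add: exponential_density_def sum_distrib_left mult_ac)
    qed (simp add: exponential_density_def)
  qed
  also have "\<dots> = (\<Sum>p=0..M - n. ?c / \<Omega>\<^sub>I * ?w p *
      (LINT y|lborel. indicator {0..} y * (exp (- y / \<Omega>\<^sub>I) * user_cdf \<eta> \<alpha> R\<^sub>D (y * \<theta>) ^ (n + p))))"
    using int by (subst Bochner_Integration.integral_sum) auto
  finally show ?thesis
    by (simp add: set_lebesgue_integral_def sum_distrib_left mult.assoc)
qed

text \<open>The event contains the rectangle where the ordered gain is at most
  \<open>\<theta>\<close> and the residual gain exceeds 1. By independence its probability is a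
  product of two positive factors.\<close>

lemma prob_ordered_gain_le_residual_pos:
  assumes n: "1 \<le> n" "n \<le> M" and pars: "R\<^sub>D > 0" "\<eta> > 0" "\<alpha> > 0" and \<Omega>: "\<Omega>\<^sub>I > 0" and \<theta>: "\<theta> > 0"
  shows "0 < prob {\<omega>\<in>space P. ordered_gain M \<eta> \<alpha> pos h n \<omega> \<le> \<theta> * (cmod (h\<^sub>I \<omega>))\<^sup>2}"
proof -
  define Z where "Z = ordered_gain M \<eta> \<alpha> pos h n"
  define Y where "Y \<omega> = (cmod (h\<^sub>I \<omega>))\<^sup>2" for \<omega>
  have ind: "indep_var borel Z borel Y"
    unfolding Z_def Y_def by (rule indep_ordered_gain_residual[OF n])
  then have [measurable]: "random_variable borel Z" "random_variable borel Y"
    by (auto dest: indep_var_rv1 indep_var_rv2)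
  let ?F = "user_cdf \<eta> \<alpha> R\<^sub>D \<theta>"
  have F: "0 < ?F" "?F \<le> 1"
    using user_cdf_pos pars \<theta> user_cdf_in_unit[of \<eta> \<alpha> \<theta>] n by auto
  have "0 < ?F ^ M" using F by simp
  \<comment> \<open>The single term \<open>k = M\<close>, in which all gains are at most
    \<open>\<theta>\<close>, already bounds the nonnegative sum from below.\<close>
  also have "\<dots> = (\<Sum>k\<in>{M}. real (M choose k) * ?F ^ k * (1 - ?F) ^ (M - k))" by simp
  also have "\<dots> \<le> (\<Sum>k=n..M. real (M choose k) * ?F ^ k * (1 - ?F) ^ (M - k))"
    using n F by (intro sum_mono2) auto
  also have "\<dots> = prob {\<omega>\<in>space P. Z \<omega> \<le> \<theta>}"
    unfolding Z_def using \<theta> by (intro prob_ordered_gain_le[symmetric] n pars) auto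
  finally have Zpos: "0 < prob {\<omega>\<in>space P. Z \<omega> \<le> \<theta>}" .
  have "prob {\<omega>\<in>space P. 1 < Y \<omega>} = exp (- 1 * (1 / \<Omega>\<^sub>I))"
    unfolding Y_def using \<Omega> by (intro exponential_distributedD_gt residual_distributed) auto
  then have "0 < prob {\<omega>\<in>space P. Z \<omega> \<le> \<theta>} * prob {\<omega>\<in>space P. 1 < Y \<omega>}"
    using Zpos by simp
  also have "\<dots> = prob ((\<lambda>\<omega>. (Z \<omega>, Y \<omega>)) -` ({..\<theta>} \<times> {1<..}) \<inter> space P)"
    by (subst indep_varD[OF ind]) (auto simp: vimage_def Int_def conj_commute)
  also have "\<dots> \<le> prob {\<omega>\<in>space P. Z \<omega> \<le> \<theta> * Y \<omega>}"
    using \<theta> by (intro finite_measure_mono)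
      (auto intro: order_trans[OF _ mult_left_mono[of 1 _ \<theta>, simplified]])
  finally show ?thesis by (simp only: Z_def Y_def)
qed

end


section \<open>High SNR limit\<close>

text \<open>Almost surely the indicators are eventually constant in \<open>t\<close>, and the
  constant 1 dominates them.\<close>

lemma (in prob_space) prob_tendsto_at_top:
  fixes Q :: "real \<Rightarrow> 'a \<Rightarrow> bool"
  assumes [measurable]: "\<And>t. Measurable.pred M (Q t)" "Measurable.pred M Q'"
    and ev: "AE \<omega> in M. eventually (\<lambda>t. Q t \<omega> \<longleftrightarrow> Q' \<omega>) at_top"
  shows "((\<lambda>t. prob {\<omega>\<in>space M. Q t \<omega>}) \<longlongrightarrow> prob {\<omega>\<in>space M. Q' \<omega>}) at_top"
proof -
  have "((\<lambda>t. LINT \<omega>|M. indicator {\<omega>\<in>space M. Q t \<omega>} \<omega>) \<longlongrightarrow>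
      (LINT \<omega>|M. indicator {\<omega>\<in>space M. Q' \<omega>} \<omega> :: real)) at_top"
  proof (rule integral_dominated_convergence_at_top[where w = "\<lambda>_. 1"])
    show "AE \<omega> in M. ((\<lambda>t. indicator {\<omega>\<in>space M. Q t \<omega>} \<omega>) \<longlongrightarrow>
        (indicator {\<omega>\<in>space M. Q' \<omega>} \<omega> :: real)) at_top"
      using ev
    proof eventually_elim
      case (elim \<omega>)
      then have "eventually (\<lambda>t. (indicator {\<omega>\<in>space M. Q t \<omega>} \<omega> :: real) = indicator {\<omega>\<in>space M. Q' \<omega>} \<omega>) at_top"
        by eventually_elim (auto split: split_indicator)
      then show ?case by (rule tendsto_eventually)
    qed
  qed (auto intro!: AE_I2 always_eventually split: split_indicator)
  then show ?thesis by (simp add: Int_def conj_ac)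
qed

lemma (in prob_space) alf_outage_tendsto:
  assumes [measurable]: "random_variable borel Z" "random_variable borel Y"
    and Z: "AE \<omega> in M. 0 < Z \<omega>" and Y: "\<And>\<omega>. 0 \<le> Y \<omega>"
    and pars: "a\<^sub>n > 0" "\<epsilon>\<^sub>n > 0" "a\<^sub>m > \<epsilon>\<^sub>m * a\<^sub>n"
  shows "((\<lambda>\<rho>. alf_outage M 1 a\<^sub>m a\<^sub>n \<epsilon>\<^sub>m \<epsilon>\<^sub>n \<rho> Z Y) \<longlongrightarrow>
    prob {\<omega>\<in>space M. Z \<omega> \<le> \<epsilon>\<^sub>n / a\<^sub>n * Y \<omega>}) at_top"
proof -
  have dec: "eventually (\<lambda>\<rho>. sinr_n_to_m a\<^sub>m a\<^sub>n \<rho> z > \<epsilon>\<^sub>m) at_top" if "z > 0" for z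
  proof -
    have "eventually (\<lambda>\<rho>. \<rho> > max 0 (\<epsilon>\<^sub>m / (z * (a\<^sub>m - \<epsilon>\<^sub>m * a\<^sub>n)))) at_top"
      by (rule eventually_gt_at_top)
    then show ?thesis
    proof eventually_elim
      case (elim \<rho>)
      have "0 < z * (a\<^sub>m - \<epsilon>\<^sub>m * a\<^sub>n)" using that pars by simp
      then have "\<epsilon>\<^sub>m < \<rho> * (z * (a\<^sub>m - \<epsilon>\<^sub>m * a\<^sub>n))" using elim by (simp add: pos_divide_less_eq)
      moreover have "0 < \<rho> * z * a\<^sub>n + 1" using elim that pars by (simp add: add_pos_pos)
      ultimately show ?case by (simp add: sinr_n_to_m_def pos_less_divide_eq algebra_simps)
    qed
  qed
  have sic: "eventually (\<lambda>\<rho>. sinr_n 1 a\<^sub>n \<rho> z y \<le> \<epsilon>\<^sub>n \<longleftrightarrow> z \<le> \<epsilon>\<^sub>n / a\<^sub>n * y) at_top" if "y \<ge> 0" for z y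
  proof -
    \<comment> \<open>Clearing the denominator isolates \<open>\<rho>\<close>: a nonpositive bracket
      satisfies the inequality for every positive \<open>\<rho>\<close>, a positive one violates it
      once \<open>\<rho>\<close> is large. The boundary case of bracket 0 agrees with the non-strict
      limit event.\<close>
    have iff: "sinr_n 1 a\<^sub>n \<rho> z y \<le> \<epsilon>\<^sub>n \<longleftrightarrow> \<rho> * (a\<^sub>n * z - \<epsilon>\<^sub>n * y) \<le> \<epsilon>\<^sub>n" if "\<rho> > 0" for \<rho>
    proof -
      have "0 < \<rho> * y + 1" using that \<open>y \<ge> 0\<close> by (simp add: add_nonneg_pos)
      then show ?thesis by (simp add: sinr_n_def pos_divide_le_eq algebra_simps)
    qed
    have "eventually (\<lambda>\<rho>. \<rho> > max 0 (\<epsilon>\<^sub>n / (a\<^sub>n * z - \<epsilon>\<^sub>n * y))) at_top"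
      by (rule eventually_gt_at_top)
    then show ?thesis
    proof eventually_elim
      case (elim \<rho>)
      show ?case
      proof (cases "z \<le> \<epsilon>\<^sub>n / a\<^sub>n * y")
        case True
        then have "a\<^sub>n * z - \<epsilon>\<^sub>n * y \<le> 0" using pars by (simp add: field_simps)
        then have "\<rho> * (a\<^sub>n * z - \<epsilon>\<^sub>n * y) \<le> 0" using elim by (simp add: mult_nonneg_nonpos)
        then show ?thesis using True iff[of \<rho>] elim pars by simp
      next
        case False
        then have "a\<^sub>n * z - \<epsilon>\<^sub>n * y > 0" using pars by (simp add: field_simps)
        then show ?thesis using False iff[of \<rho>] elim by (simp add: pos_divide_less_eq)
      qed
    qed
  qed
  have [measurable]: "Measurable.pred M (\<lambda>\<omega>. sinr_n_to_m a\<^sub>m a\<^sub>n \<rho> (Z \<omega>) \<le> \<epsilon>\<^sub>m)"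
    "Measurable.pred M (\<lambda>\<omega>. sinr_n_to_m a\<^sub>m a\<^sub>n \<rho> (Z \<omega>) > \<epsilon>\<^sub>m)"
    "Measurable.pred M (\<lambda>\<omega>. sinr_n_to_n a\<^sub>m a\<^sub>n \<rho> (Z \<omega>) \<le> \<epsilon>\<^sub>n)"
    "Measurable.pred M (\<lambda>\<omega>. sinr_n 1 a\<^sub>n \<rho> (Z \<omega>) (Y \<omega>) \<le> \<epsilon>\<^sub>n)" for \<rho>
    unfolding sinr_n_to_m_def sinr_n_to_n_def sinr_n_def by measurable
  have "((\<lambda>\<rho>. prob {\<omega>\<in>space M. sinr_n_to_m a\<^sub>m a\<^sub>n \<rho> (Z \<omega>) \<le> \<epsilon>\<^sub>m \<and> sinr_n_to_n a\<^sub>m a\<^sub>n \<rho> (Z \<omega>) \<le> \<epsilon>\<^sub>n})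
      \<longlongrightarrow> prob {\<omega>\<in>space M. False}) at_top"
  proof (rule prob_tendsto_at_top)
    show "AE \<omega> in M. eventually (\<lambda>\<rho>. (sinr_n_to_m a\<^sub>m a\<^sub>n \<rho> (Z \<omega>) \<le> \<epsilon>\<^sub>m
        \<and> sinr_n_to_n a\<^sub>m a\<^sub>n \<rho> (Z \<omega>) \<le> \<epsilon>\<^sub>n) \<longleftrightarrow> False) at_top"
      using Z by eventually_elim (rule eventually_mono[OF dec], auto)
  qed measurable
  moreover have "((\<lambda>\<rho>. prob {\<omega>\<in>space M. sinr_n_to_m a\<^sub>m a\<^sub>n \<rho> (Z \<omega>) > \<epsilon>\<^sub>m \<and> sinr_n 1 a\<^sub>n \<rho> (Z \<omega>) (Y \<omega>) \<le> \<epsilon>\<^sub>n})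
      \<longlongrightarrow> prob {\<omega>\<in>space M. Z \<omega> \<le> \<epsilon>\<^sub>n / a\<^sub>n * Y \<omega>}) at_top"
  proof (rule prob_tendsto_at_top)
    show "AE \<omega> in M. eventually (\<lambda>\<rho>. (sinr_n_to_m a\<^sub>m a\<^sub>n \<rho> (Z \<omega>) > \<epsilon>\<^sub>m
        \<and> sinr_n 1 a\<^sub>n \<rho> (Z \<omega>) (Y \<omega>) \<le> \<epsilon>\<^sub>n) \<longleftrightarrow> Z \<omega> \<le> \<epsilon>\<^sub>n / a\<^sub>n * Y \<omega>) at_top"
      using Z by eventually_elim (rule eventually_elim2[OF dec sic[OF Y]], auto)
  qed measurable
  ultimately show ?thesis
    unfolding alf_outage_def using tendsto_add by fastforce
qed

lemma alf_asymptotic_leading_tendsto_0: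
  fixes \<zeta> :: "real \<Rightarrow> real"
  assumes "(\<zeta> \<longlongrightarrow> 0) F" "n \<ge> 1"
  shows "((\<lambda>\<rho>. a * (\<zeta> \<rho> * b) ^ n) \<longlongrightarrow> 0) F"
  using tendsto_mult_left[OF tendsto_power[OF tendsto_mult_right[OF assms(1), of b], of n], of a] assms(2)
  by (simp add: power_0_left)

text \<open>Convergence in \<open>U\<close> is asserted alongside the ratio because
  \<open>lim\<close> carries no information for a divergent sequence.\<close>

theorem corollary8:
  fixes P :: "'w measure"
    and M m n :: nat
    and \<eta> \<alpha> R\<^sub>D \<Omega>\<^sub>I a\<^sub>m a\<^sub>n R\<^sub>m R\<^sub>n \<epsilon>\<^sub>m \<epsilon>\<^sub>n varpi vartheta :: real
    and \<tau> \<upsilon> \<zeta> :: "real \<Rightarrow> real"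
    and pos h :: "nat \<Rightarrow> 'w \<Rightarrow> complex"
    and h\<^sub>I :: "'w \<Rightarrow> complex"
    and Z :: "nat \<Rightarrow> 'w \<Rightarrow> real"
    and Y\<^sub>I :: "'w \<Rightarrow> real"
  assumes "M \<ge> 2" and "1 \<le> m" and "m < n" and "n \<le> M"
    and "\<eta> > 0" and "\<alpha> > 0" and "R\<^sub>D > 0" and "\<Omega>\<^sub>I > 0"
    and "a\<^sub>m > a\<^sub>n" and "a\<^sub>n > 0" and "a\<^sub>m + a\<^sub>n = 1"
    and "R\<^sub>m > 0" and "R\<^sub>n > 0"
    and "\<epsilon>\<^sub>m = 2 powr R\<^sub>m - 1" and "\<epsilon>\<^sub>n = 2 powr R\<^sub>n - 1"
    and "noma_downlink P M R\<^sub>D \<Omega>\<^sub>I pos h h\<^sub>I"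
    and "Z = ordered_gain M \<eta> \<alpha> pos h"
    and "Y\<^sub>I = (\<lambda>\<omega>. (cmod (h\<^sub>I \<omega>))\<^sup>2)"
    and "varpi = 1"
    and "a\<^sub>m > \<epsilon>\<^sub>m * a\<^sub>n" and "a\<^sub>n > \<epsilon>\<^sub>n * a\<^sub>m"
    and "\<tau> = (\<lambda>\<rho>. \<epsilon>\<^sub>m / (\<rho> * (a\<^sub>m - \<epsilon>\<^sub>m * a\<^sub>n)))"
    and "\<upsilon> = (\<lambda>\<rho>. \<epsilon>\<^sub>n / (\<rho> * (a\<^sub>n - \<epsilon>\<^sub>n * a\<^sub>m)))"
    and "\<zeta> = (\<lambda>\<rho>. min (\<tau> \<rho>) (\<upsilon> \<rho>))"
    and "vartheta = varpi * \<epsilon>\<^sub>n / a\<^sub>n"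
  shows "(\<forall>\<rho>>0. convergent (\<lambda>U. alf_asymptotic M n \<eta> \<alpha> R\<^sub>D \<Omega>\<^sub>I (\<zeta> \<rho>) (\<tau> \<rho>) vartheta U)) \<and>
    ((\<lambda>\<rho>. alf_outage P varpi a\<^sub>m a\<^sub>n \<epsilon>\<^sub>m \<epsilon>\<^sub>n \<rho> (Z n) Y\<^sub>I /
          lim (\<lambda>U. alf_asymptotic M n \<eta> \<alpha> R\<^sub>D \<Omega>\<^sub>I (\<zeta> \<rho>) (\<tau> \<rho>) vartheta U)) \<longlongrightarrow> 1) at_top"
proof -
  interpret noma_downlink P M R\<^sub>D \<Omega>\<^sub>I pos h h\<^sub>I by fact
  have n: "1 \<le> n" "n \<le> M" using assms by auto
  have \<epsilon>: "\<epsilon>\<^sub>m > 0" "\<epsilon>\<^sub>n > 0" using assms by auto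
  then have \<theta>: "vartheta = \<epsilon>\<^sub>n / a\<^sub>n" "vartheta > 0" using assms by auto
  let ?p = "prob {\<omega>\<in>space P. ordered_gain M \<eta> \<alpha> pos h n \<omega> \<le> vartheta * (cmod (h\<^sub>I \<omega>))\<^sup>2}"
  let ?b = "integral {0..R\<^sub>D\<^sup>2} (\<lambda>s. 1 + sqrt s powr \<alpha>) / R\<^sub>D\<^sup>2 / \<eta>"
  let ?a = "fact M / (fact (M - n) * fact n) :: real"
  define L where "L \<rho> = ?a * (\<zeta> \<rho> * ?b) ^ n - ?a * (\<tau> \<rho> * ?b) ^ n + ?p" for \<rho>
  have p: "0 < ?p"
    by (intro prob_ordered_gain_le_residual_pos n assms \<theta>)
  \<comment> \<open>Rewriting the floor \<open>?p\<close> as its weighted sum of integrals makes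
    \<open>L\<close> literally the limit of the quadrature expression.\<close>
  have L: "alf_asymptotic M n \<eta> \<alpha> R\<^sub>D \<Omega>\<^sub>I (\<zeta> \<rho>) (\<tau> \<rho>) vartheta \<longlonglongrightarrow> L \<rho>" for \<rho>
    unfolding L_def prob_ordered_gain_le_residual[OF n \<open>R\<^sub>D > 0\<close> \<open>\<eta> > 0\<close> \<open>\<alpha> > 0\<close> \<open>\<Omega>\<^sub>I > 0\<close> less_imp_le[OF \<theta>(2)]]
    by (intro alf_asymptotic_tendsto assms less_imp_le[OF \<theta>(2)])
  \<comment> \<open>The two conditions on the power coefficients make the factors multiplying
    \<open>\<rho>\<close> in the denominators positive.\<close>
  have \<tau>: "(\<tau> \<longlongrightarrow> 0) at_top" and \<upsilon>: "(\<upsilon> \<longlongrightarrow> 0) at_top"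
    unfolding assms using assms
    by (auto intro!: real_tendsto_divide_at_top filterlim_at_top_mult_tendsto_pos filterlim_ident tendsto_const)
  have "(\<zeta> \<longlongrightarrow> 0) at_top"
    using tendsto_min[OF \<tau> \<upsilon>] assms by simp
  then have L0: "(L \<longlongrightarrow> 0 - 0 + ?p) at_top"
    unfolding L_def by (intro tendsto_intros alf_asymptotic_leading_tendsto_0 \<tau> n)
  have "((\<lambda>\<rho>. alf_outage P 1 a\<^sub>m a\<^sub>n \<epsilon>\<^sub>m \<epsilon>\<^sub>n \<rho> (Z n) Y\<^sub>I) \<longlongrightarrow> ?p) at_top"
    unfolding \<theta>(1) \<open>Z = _\<close> \<open>Y\<^sub>I = _\<close>
    by (intro alf_outage_tendsto AE_ordered_gain_pos n assms \<epsilon> random_variable_ordered_gain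
        indep_var_rv2[OF indep_ordered_gain_residual[OF n]]) auto
  from tendsto_divide[OF this L0] p
  have "((\<lambda>\<rho>. alf_outage P 1 a\<^sub>m a\<^sub>n \<epsilon>\<^sub>m \<epsilon>\<^sub>n \<rho> (Z n) Y\<^sub>I / L \<rho>) \<longlongrightarrow> 1) at_top"
    by simp
  then show ?thesis
    using L limI[OF L] \<open>varpi = 1\<close> by (auto intro: convergentI)
qed


end
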